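(* Consider the Constrained-degree percolation model on the square lattice $\mathbb{L}^2=(\mathbb{Z}^2,\mathcal{E}^2)$ in which the vertex constraints are i.i.d. with law $\rho=(\rho_0,\rho_1,\rho_2,\rho_3)$ on $\{0,1,2,3\}$, and let $\mathbb{P}_{\rho,t}$ be the law of the percolation configuration $\omega_t$ at time $t\in[0,1]$. There exists a constant $\eta>0$ such that, for every probability vector $\rho=(\rho_0,\rho_1,\rho_2,\rho_3)$ and every $t$ with $(\rho_3,t)\in(1-\eta,1]^2$, $$\mathbb{P}_{\rho,t}(0\longleftrightarrow\infty)>0.$$
   Context: $\mathbb{L}^2=(\mathbb{Z}^2,\mathcal{E}^2)$ is the square lattice with nearest-neighbour edges. Constrained-degree percolation in random environment. Let $\rho=(\rho_0,\rho_1,\rho_2,\rho_3)$ be a probability vector. Let $\kappa=\{\kappa_v\}_{v\in\mathbb{Z}^2}$ be i.i.d. random variables (constraints) with $\kappa_v=j$ with probability $\rho_j$, $j\in\{0,1,2,3\}$; their product law is $\mathbb{P}_\rho$. Let $U=\{U_e\}_{e\in\mathcal{E}^2}$ be i.i.d. uniform random variables on $[0,1]$ (clocks), with product law $\mathbb{P}$, independent of $\kappa$. The continuous-time configuration $\omega_t=\omega_t(U,\kappa)\in\{0,1\}^{\mathcal{E}^2}$, $t\in[0,1]$, is built as follows. At time $0$ all edges are closed. Each edge $e=\langle u,v\rangle$ opens at time $U_e$ if $\deg(u,U_e)<\kappa_u$ and $\deg(v,U_e)<\kappa_v$, where $\deg(w,s)$ is the number of open edges incident to $w$ at time $s$ (immediately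 before the possible opening of $e$ when $s=U_e$); otherwise $e$ stays closed forever. Once open, an edge remains open. That is, $$\omega_t(e)=\mathbb{1}_{\{U_e\le t\}}\,\mathbb{1}_{\{\deg(u,U_e)<\kappa_u\}}\,\mathbb{1}_{\{\deg(v,U_e)<\kappa_v\}}.$$ This is well defined for almost all $(U,\kappa)$ and all $t\in[0,1]$. The edge $e$ is $t$-open if $\omega_t(e)=1$ and $t$-closed otherwise. The law of $\omega_t$ is $\mathbb{P}_{\rho,t}(A)=(\mathbb{P}\times\mathbb{P}_\rho)(\omega_t^{-1}(A))$ for events $A\subset\{0,1\}^{\mathcal{E}^2}$. $\{0\longleftrightarrow\infty\}$ is the event that the origin belongs to an infinite connected component of open edges. *)

theory Defs
  imports "HOL-Probability.Probability"
begin

type_synonym vertex = "int \<times> int"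
type_synonym edge = "vertex set"

definition lattice_edges :: "edge set" where
  "lattice_edges = {{u, v} | u v. \<bar>fst u - fst v\<bar> + \<bar>snd u - snd v\<bar> = 1}"

text \<open>Whether an edge opens depends only on the edges meeting it whose clocks rang earlier, so the
  dynamics is a recursion along the relation below. For almost all clocks this relation is
  well-founded: a given path of \<open>n\<close> edges has decreasing clocks with probability \<open>1 / n!\<close>.\<close>

definition earlier :: "(edge \<Rightarrow> real) \<Rightarrow> (edge \<times> edge) set" where
  "earlier U = {(f, e). f \<in> lattice_edges \<and> e \<in> lattice_edges \<and> f \<inter> e \<noteq> {} \<and> U f < U e}"

text \<open>For an edge \<open>e\<close>, \<open>opens U \<kappa> e\<close> says that the attempt to open \<open>e\<close> at time \<open>U e\<close> succeeds. On the
  null set of clocks for which the recursion is not well-founded, all edges stay closed.\<close>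

definition opens :: "(edge \<Rightarrow> real) \<Rightarrow> (vertex \<Rightarrow> nat) \<Rightarrow> edge \<Rightarrow> bool" where
  "opens U \<kappa> e \<longleftrightarrow> wf (earlier U) \<and>
     wfrec (earlier U)
       (\<lambda>opn e. \<forall>v\<in>e. card {f \<in> lattice_edges. v \<in> f \<and> U f < U e \<and> opn f} < \<kappa> v) e"

definition cdp_config :: "(edge \<Rightarrow> real) \<Rightarrow> (vertex \<Rightarrow> nat) \<Rightarrow> real \<Rightarrow> edge \<Rightarrow> bool" where
  "cdp_config U \<kappa> t = (\<lambda>e\<in>lattice_edges. U e \<le> t \<and> opens U \<kappa> e)"

text \<open>The degree of \<open>w\<close> immediately before time \<open>s\<close> in an evolution \<open>\<omega>\<close>.\<close>

definition deg_before :: "(real \<Rightarrow> edge \<Rightarrow> bool) \<Rightarrow> vertex \<Rightarrow> real \<Rightarrow> nat" where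
  "deg_before \<omega> w s = card {f \<in> lattice_edges. w \<in> f \<and> (\<exists>r<s. \<omega> r f)}"

text \<open>Whenever the recursion is well-founded, \<open>cdp_config\<close> is the unique solution of the equation
  defining the process.\<close>

lemma cdp_config_eq:
  assumes wf: "wf (earlier U)" and e: "e \<in> lattice_edges"
  shows "cdp_config U \<kappa> t e \<longleftrightarrow>
    U e \<le> t \<and> (\<forall>v\<in>e. deg_before (cdp_config U \<kappa>) v (U e) < \<kappa> v)"
proof -
  define G where "G = (\<lambda>opn e. \<forall>v\<in>e. card {f \<in> lattice_edges. v \<in> f \<and> U f < U e \<and> opn f} < \<kappa> v)"
  have op: "opens U \<kappa> = wfrec (earlier U) G"
    using wf by (auto simp: opens_def G_def fun_eq_iff)
  have "opens U \<kappa> e = G (cut (opens U \<kappa>) (earlier U) e) e"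
    unfolding op by (rule wfrec[OF wf])
  also have "\<dots> = G (opens U \<kappa>) e"
  proof -
    have "{f \<in> lattice_edges. v \<in> f \<and> U f < U e \<and> cut (opens U \<kappa>) (earlier U) e f} =
          {f \<in> lattice_edges. v \<in> f \<and> U f < U e \<and> opens U \<kappa> f}" if "v \<in> e" for v
      using e that by (auto simp: cut_def earlier_def)
    then show ?thesis by (simp add: G_def)
  qed
  also have "\<dots> \<longleftrightarrow> (\<forall>v\<in>e. deg_before (cdp_config U \<kappa>) v (U e) < \<kappa> v)"
  proof -
    have "{f \<in> lattice_edges. v \<in> f \<and> U f < U e \<and> opens U \<kappa> f} =
          {f \<in> lattice_edges. v \<in> f \<and> (\<exists>r<U e. cdp_config U \<kappa> r f)}" for v
      by (auto simp: cdp_config_def)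
    then show ?thesis by (simp add: G_def deg_before_def)
  qed
  finally show ?thesis using e by (simp add: cdp_config_def)
qed

lemma cdp_config_unique:
  assumes wf: "wf (earlier U)"
    and sol: "\<And>e t. e \<in> lattice_edges \<Longrightarrow>
      \<omega> t e \<longleftrightarrow> U e \<le> t \<and> (\<forall>v\<in>e. deg_before \<omega> v (U e) < \<kappa> v)"
    and e: "e \<in> lattice_edges"
  shows "\<omega> t e = cdp_config U \<kappa> t e"
  using wf e
proof (induction e arbitrary: t rule: wf_induct_rule)
  case (less e)
  have "deg_before \<omega> v (U e) = deg_before (cdp_config U \<kappa>) v (U e)" if v: "v \<in> e" for v
  proof -
    have "(\<exists>r<U e. \<omega> r f) = (\<exists>r<U e. cdp_config U \<kappa> r f)"
      if f: "f \<in> lattice_edges" "v \<in> f" for f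
    proof (cases "U f < U e")
      case True
      then have "(f, e) \<in> earlier U" using f v less.prems by (auto simp: earlier_def)
      from less.IH[OF this f(1)] show ?thesis by simp
    next
      case False
      then show ?thesis using sol[OF f(1)] cdp_config_eq[OF wf f(1)] by fastforce
    qed
    then show ?thesis unfolding deg_before_def by (metis (no_types, lifting))
  qed
  then show ?case using sol[OF less.prems] cdp_config_eq[OF wf less.prems] by simp
qed

definition clock_measure :: "(edge \<Rightarrow> real) measure" where
  "clock_measure = (\<Pi>\<^sub>M e\<in>lattice_edges. uniform_measure lborel {0..1})"

definition constraint_measure :: "nat pmf \<Rightarrow> (vertex \<Rightarrow> nat) measure" where
  "constraint_measure \<rho> = (\<Pi>\<^sub>M v\<in>UNIV. measure_pmf \<rho>)"

definition config_space :: "(edge \<Rightarrow> bool) measure" where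
  "config_space = (\<Pi>\<^sub>M e\<in>lattice_edges. count_space UNIV)"

definition cdp_law :: "nat pmf \<Rightarrow> real \<Rightarrow> (edge \<Rightarrow> bool) measure" where
  "cdp_law \<rho> t =
     distr (clock_measure \<Otimes>\<^sub>M constraint_measure \<rho>) config_space (\<lambda>(U, \<kappa>). cdp_config U \<kappa> t)"

definition open_cluster :: "(edge \<Rightarrow> bool) \<Rightarrow> vertex \<Rightarrow> vertex set" where
  "open_cluster \<omega> x = {(u, v). {u, v} \<in> lattice_edges \<and> \<omega> {u, v}}\<^sup>* `` {x}"

definition origin_percolates :: "(edge \<Rightarrow> bool) set" where
  "origin_percolates = {\<omega> \<in> space config_space. infinite (open_cluster \<omega> (0, 0))}"

end

theory Submission
  imports Defs
begin

text \<open>A Peierls argument. If the clusters of \<open>(0, 0), \<dots>, (0, N)\<close> are all finite, following the boundary of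
  their union yields, for some \<open>k \<ge> N\<close>, a dual path of \<open>k + 1\<close> distinct closed edges that starts at
  \<open>(0, k)\<close>. Up to rare defects (a late clock or a constraint other than three), each closed edge \<open>e\<close> has
  an endpoint, its pivot, whose other three edges rang before \<open>e\<close> and are open. Since consecutive
  edges of the path share the vertex inside a turn, and this vertex cannot be a pivot, each step admits
  at most three choices of turn and pivot instead of six. Integrating out the clocks of the path and
  applying Cauchy--Schwarz to the pivots of either parity bounds the probability of a given path with
  \<open>n\<close> pivots by \<open>c\<^sup>n\<close>, where \<open>c\<^sup>2 = E (1 - M)\<^sup>2 = 1 / 10\<close> for the maximum \<open>M\<close> of three uniform clocks. As
  \<open>3 / sqrt 10 < 1\<close>, the expected number of such paths is summable in \<open>k\<close>, with room for a small
  density of defects, so some vertex percolates with positive probability; by translation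
  invariance so does the origin.\<close>

section \<open>Boundary contours of finite sets\<close>

text \<open>The contour is handled combinatorially, as an orbit of a permutation of boundary darts,
  and its length is read off a discrete winding number. A whole segment of the axis is used instead
  of the origin because the union bound over \<open>k\<close> is a geometric series, which drops
  below 1 only if it starts at a large \<open>N\<close>. Three turns and two pivots would cost 6 /
  sqrt 10 > 1 per step, so the argument hinges on excluding half of these pairs. There are two
  obstacles to independence. The event that \<open>e\<close> rang last at its pivot involves three
  further clocks; these belong to open edges, which never lie on the contour, so given them the
  contour clocks are still independent. Moreover an edge joining two pivots belongs to the
  neighbourhoods of both; such pivots have opposite parity, which is why the pivots are separated by
  parity. Pivots of the same parity cause no trouble: two contour edges cannot share a pivot, since
  each would then be open by the explanation of the other.\<close>

definition unit_vectors :: "vertex set" where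
  "unit_vectors = {(1, 0), (0, 1), (-1, 0), (0, -1)}"

definition rot :: "vertex \<Rightarrow> vertex" where
  "rot d = (- snd d, fst d)"

text \<open>The dart \<open>(x, d)\<close> stands for the edge from \<open>x\<close> to \<open>x + d\<close>, crossed by a walker on the dual lattice
  who heads in direction \<open>rot d\<close> and has \<open>x\<close> on the left.\<close>

type_synonym dart = "vertex \<times> vertex"

datatype turn = Ahead | Left | Right

fun turn_dart :: "turn \<Rightarrow> dart \<Rightarrow> dart" where
  "turn_dart Ahead (x, d) = (x + rot d, d)"
| "turn_dart Left (x, d) = (x, rot d)"
| "turn_dart Right (x, d) = (x + d + rot d, - rot d)"

fun dart_edge :: "dart \<Rightarrow> edge" where
  "dart_edge (x, d) = {x, x + d}"

fun walk :: "dart \<Rightarrow> turn list \<Rightarrow> dart list" where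
  "walk p [] = [p]"
| "walk p (m # ms) = p # walk (turn_dart m p) ms"

definition boundary :: "vertex set \<Rightarrow> dart set" where
  "boundary C = {(x, d). d \<in> unit_vectors \<and> x \<in> C \<and> x + d \<notin> C}"

text \<open>When \<open>C\<close> contains exactly two opposite corners of the face ahead, the
  walker turns left and stays with \<open>x\<close>. \<open>prev_dart\<close> resolves this tie in
  the same way, which makes the step reversible.\<close>

fun next_turn :: "vertex set \<Rightarrow> dart \<Rightarrow> turn" where
  "next_turn C (x, d) =
     (if x + rot d \<notin> C then Left else if x + d + rot d \<notin> C then Ahead else Right)"

definition next_dart :: "vertex set \<Rightarrow> dart \<Rightarrow> dart" where
  "next_dart C p = turn_dart (next_turn C p) p"

fun prev_dart :: "vertex set \<Rightarrow> dart \<Rightarrow> dart" where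
  "prev_dart C (x, d) =
     (if x - rot d \<notin> C then (x, - rot d) else if x - rot d + d \<notin> C then (x - rot d, d)
      else (x - rot d + d, rot d))"

lemma rot_simps [simp]: "rot (rot d) = - d" "rot (- d) = - rot d"
  by (auto simp: rot_def prod_eq_iff)

lemma rot_unit [simp]: "d \<in> unit_vectors \<Longrightarrow> rot d \<in> unit_vectors"
  and minus_unit [simp]: "d \<in> unit_vectors \<Longrightarrow> - d \<in> unit_vectors"
  by (auto simp: rot_def unit_vectors_def)

lemma turn_dart_unit: "snd p \<in> unit_vectors \<Longrightarrow> snd (turn_dart m p) \<in> unit_vectors"
  by (cases "(m, p)" rule: turn_dart.cases) auto

lemma next_dart_boundary: "p \<in> boundary C \<Longrightarrow> next_dart C p \<in> boundary C"
proof -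
  obtain x d where "p = (x, d)" by (metis surj_pair)
  then show "p \<in> boundary C \<Longrightarrow> next_dart C p \<in> boundary C"
    by (simp add: boundary_def next_dart_def add_ac)
qed

lemma prev_next_dart: "p \<in> boundary C \<Longrightarrow> prev_dart C (next_dart C p) = p"
proof -
  obtain x d where "p = (x, d)" by (metis surj_pair)
  then show "p \<in> boundary C \<Longrightarrow> prev_dart C (next_dart C p) = p"
    by (simp add: boundary_def next_dart_def algebra_simps)
qed

lemma inj_on_next_dart: "inj_on (next_dart C) (boundary C)"
  by (rule inj_on_inverseI) (rule prev_next_dart)

lemma finite_boundary: "finite C \<Longrightarrow> finite (boundary C)"
  by (rule finite_subset[of _ "C \<times> unit_vectors"]) (auto simp: boundary_def unit_vectors_def)

lemma dart_edge_lattice: "snd p \<in> unit_vectors \<Longrightarrow> dart_edge p \<in> lattice_edges"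
  by (cases p) (force simp: lattice_edges_def unit_vectors_def)

text \<open>Exactly one endpoint of an edge crossed by a boundary dart lies in \<open>C\<close>, and
  it is the base of the dart. Distinct darts of a contour thus cross distinct edges.\<close>

lemma inj_on_dart_edge: "inj_on dart_edge (boundary C)"
  by (auto simp: inj_on_def boundary_def doubleton_eq_iff)

text \<open>Twice the centre of the face ahead of a dart, respectively behind it.\<close>

fun face_ahead :: "dart \<Rightarrow> vertex" where
  "face_ahead (x, d) = x + x + d + rot d"

fun face_behind :: "dart \<Rightarrow> vertex" where
  "face_behind (x, d) = x + x + d - rot d"

lemma face_behind_next: "face_behind (next_dart C p) = face_ahead p"
proof -
  obtain x d where "p = (x, d)" by (metis surj_pair)
  then show ?thesis by (simp add: next_dart_def algebra_simps)
qed

lemma face_ahead_odd: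
  assumes "snd p \<in> unit_vectors"
  shows "face_ahead p = (2 * a + 1, 2 * b + 1) \<longleftrightarrow>
    p \<in> {((a, b), (1, 0)), ((a + 1, b), (0, 1)), ((a + 1, b + 1), (-1, 0)), ((a, b + 1), (0, -1))}"
proof -
  obtain x y d where p: "p = ((x, y), d)" by (metis surj_pair)
  from assms consider "d = (1, 0)" | "d = (0, 1)" | "d = (-1, 0)" | "d = (0, -1)"
    by (auto simp: unit_vectors_def p)
  then show ?thesis by cases (simp_all add: p rot_def, presburger+)
qed

lemma face_behind_odd:
  assumes "snd p \<in> unit_vectors"
  shows "face_behind p = (2 * a + 1, 2 * b + 1) \<longleftrightarrow>
    p \<in> {((a + 1, b), (-1, 0)), ((a + 1, b + 1), (0, -1)), ((a, b + 1), (1, 0)), ((a, b), (0, 1))}"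
proof -
  obtain x y d where p: "p = ((x, y), d)" by (metis surj_pair)
  from assms consider "d = (1, 0)" | "d = (0, 1)" | "d = (-1, 0)" | "d = (0, -1)"
    by (auto simp: unit_vectors_def p)
  then show ?thesis by cases (simp_all add: p rot_def, presburger+)
qed

section \<open>Flux across lattice edges and winding numbers\<close>

definition hflux :: "dart set \<Rightarrow> int \<Rightarrow> int \<Rightarrow> int" where
  "hflux G a b = of_bool (((a, b), (1, 0)) \<in> G) - of_bool (((a + 1, b), (-1, 0)) \<in> G)"

definition vflux :: "dart set \<Rightarrow> int \<Rightarrow> int \<Rightarrow> int" where
  "vflux G a b = of_bool (((a, b), (0, 1)) \<in> G) - of_bool (((a, b + 1), (0, -1)) \<in> G)"

lemma card_Int_4:
  assumes "finite G" "distinct [p, q, r, s]"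
  shows "int (card (G \<inter> {p, q, r, s})) =
    of_bool (p \<in> G) + of_bool (q \<in> G) + of_bool (r \<in> G) + of_bool (s \<in> G)"
proof -
  have "int (card (G \<inter> A)) = (\<Sum>x\<in>A. of_bool (x \<in> G))" if "finite A" for A
    using that by (simp add: Int_commute)
  from this[of "{p, q, r, s}"] show ?thesis using assms(2) by simp
qed

text \<open>\<open>G\<close> is a union of closed contours, so the face with lower left corner
  \<open>(a, b)\<close> is entered as often as it is left; sorting the eight possible darts by the
  edge they cross gives the identity. It makes the flux a closed discrete form, and
  \<open>winding\<close> is its potential.\<close>

lemma flux_curl_free:
  assumes fin: "finite G" and G: "G \<subseteq> boundary C" and perm: "next_dart C ` G = G"
  shows "hflux G a b + vflux G (a + 1) b = vflux G a b + hflux G a (b + 1)"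
proof -
  let ?z = "(2 * a + 1, 2 * b + 1)"
  have unit: "snd p \<in> unit_vectors" if "p \<in> G" for p
    using that G by (auto simp: boundary_def)
  have "bij_betw (next_dart C) {p \<in> G. face_ahead p = ?z} {p \<in> G. face_behind p = ?z}"
  proof (rule bij_betw_imageI)
    show "inj_on (next_dart C) {p \<in> G. face_ahead p = ?z}"
      by (rule inj_on_subset[OF inj_on_next_dart]) (use G in auto)
    show "next_dart C ` {p \<in> G. face_ahead p = ?z} = {p \<in> G. face_behind p = ?z}"
      (is "_ ` ?A = ?B")
    proof
      show "next_dart C ` ?A \<subseteq> ?B" using perm by (auto simp: face_behind_next)
      show "?B \<subseteq> next_dart C ` ?A"
      proof
        fix p assume p: "p \<in> ?B"
        then obtain q where "q \<in> G" "p = next_dart C q" using perm by blast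
        then show "p \<in> next_dart C ` ?A" using p by (simp add: face_behind_next)
      qed
    qed
  qed
  then have eq: "card {p \<in> G. face_ahead p = ?z} = card {p \<in> G. face_behind p = ?z}"
    by (rule bij_betw_same_card)
  have "{p \<in> G. face_ahead p = ?z} =
      G \<inter> {((a, b), (1, 0)), ((a + 1, b), (0, 1)), ((a + 1, b + 1), (-1, 0)), ((a, b + 1), (0, -1))}"
    using face_ahead_odd[OF unit] by blast
  moreover have "{p \<in> G. face_behind p = ?z} =
      G \<inter> {((a + 1, b), (-1, 0)), ((a + 1, b + 1), (0, -1)), ((a, b + 1), (1, 0)), ((a, b), (0, 1))}"
    using face_behind_odd[OF unit] by blast
  ultimately have "of_bool (((a, b), (1, 0)) \<in> G) + of_bool (((a + 1, b), (0, 1)) \<in> G) +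
      of_bool (((a + 1, b + 1), (-1, 0)) \<in> G) + of_bool (((a, b + 1), (0, -1)) \<in> G) =
    (of_bool (((a + 1, b), (-1, 0)) \<in> G) + of_bool (((a + 1, b + 1), (0, -1)) \<in> G) +
      of_bool (((a, b + 1), (1, 0)) \<in> G) + of_bool (((a, b), (0, 1)) \<in> G) :: int)"
    using eq by (subst (1 2) card_Int_4[OF fin, symmetric]) simp_all
  moreover have "x1 - y1 + (x2 - y2) = y4 - x4 + (y3 - x3)"
    if "x1 + x2 + x3 + x4 = y1 + y2 + y3 + y4" for x1 x2 x3 x4 y1 y2 y3 y4 :: int
    using that by simp
  ultimately show ?thesis
    unfolding hflux_def vflux_def by blast
qed

text \<open>The winding number of a closed contour around \<open>(a, b)\<close>, read off along the horizontal ray to the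
  right of \<open>(a, b)\<close>; \<open>M\<close> is any number beyond the contour.\<close>

definition winding :: "dart set \<Rightarrow> int \<Rightarrow> int \<Rightarrow> int \<Rightarrow> int" where
  "winding G M a b = (\<Sum>k\<in>{a..M}. hflux G k b)"

lemma winding_right:
  assumes "a \<le> M"
  shows "winding G M a b = hflux G a b + winding G M (a + 1) b"
proof -
  have "{a..M} = insert a {a + 1..M}" using assms by auto
  then show ?thesis by (simp add: winding_def)
qed

text \<open>Adding the curl identity over the faces of the row from column \<open>a\<close> to
  \<open>M\<close> telescopes: of the vertical fluxes only those at \<open>a\<close> and
  \<open>M + 1\<close> survive, and the latter is zero.\<close>

lemma winding_up:
  assumes curl: "\<And>a b. hflux G a b + vflux G (a + 1) b = vflux G a b + hflux G a (b + 1)"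
    and far: "\<And>b. vflux G (M + 1) b = 0" and "a \<le> M + 1"
  shows "winding G M a b = vflux G a b + winding G M a (b + 1)"
  using \<open>a \<le> M + 1\<close>
proof (induction a rule: int_le_induct)
  case base
  then show ?case using far by (simp add: winding_def)
next
  case (step i)
  have "winding G M (i - 1) b = hflux G (i - 1) b + winding G M i b" for b
    using winding_right[of "i - 1" M] step.hyps by simp
  then show ?case using step.IH curl[of "i - 1" b] by simp
qed

text \<open>Connectedness is encoded as an induction principle, so that no paths have to be
  handled.\<close>

definition lattice_connected :: "vertex set \<Rightarrow> vertex \<Rightarrow> bool" where
  "lattice_connected C x \<longleftrightarrow>
     (\<forall>A. x \<in> A \<and> (\<forall>y\<in>A. \<forall>d\<in>unit_vectors. y \<in> C \<longrightarrow> y + d \<in> C \<longrightarrow> y + d \<in> A) \<longrightarrow> C \<subseteq> A)"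

lemma lattice_connectedD:
  assumes "lattice_connected C x" "P x"
    and "\<And>y d. y \<in> C \<Longrightarrow> P y \<Longrightarrow> d \<in> unit_vectors \<Longrightarrow> y + d \<in> C \<Longrightarrow> P (y + d)" "y \<in> C"
  shows "P y"
  using assms(1)[unfolded lattice_connected_def, rule_format, of "{y. P y}"] assms(2-) by auto

text \<open>Moving to a lattice neighbour changes the winding number by the flux across the edge
  walked along, and boundary darts cross no edge with both endpoints in \<open>C\<close>.\<close>

lemma winding_constant:
  assumes fin: "finite C" and conn: "lattice_connected C x"
    and G: "G \<subseteq> boundary C" and perm: "next_dart C ` G = G"
    and M: "\<And>a b. (a, b) \<in> C \<Longrightarrow> a < M"
    and y: "y \<in> C"
  shows "winding G M (fst y) (snd y) = winding G M (fst x) (snd x)"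
proof (rule lattice_connectedD[OF conn _ _ y,
    where P = "\<lambda>y. winding G M (fst y) (snd y) = winding G M (fst x) (snd x)"])
  fix y d assume y: "y \<in> C" "y + d \<in> C" and d: "d \<in> unit_vectors"
    and IH: "winding G M (fst y) (snd y) = winding G M (fst x) (snd x)"
  obtain a b where ab: "y = (a, b)" by (cases y)
  have finG: "finite G" using finite_subset[OF G finite_boundary[OF fin]] .
  note curl = flux_curl_free[OF finG G perm]
  have G_iff: "(p, e) \<notin> G" if "p \<notin> C \<or> p + e \<in> C" for p e
    using that G by (auto simp: boundary_def)
  have "(a, b) \<notin> C" if "M < a" for a b
    using M[of a b] that by auto
  then have far: "vflux G (M + 1) b = 0" for b
    by (simp add: vflux_def G_iff)
  have aM: "a < M" using M y ab by auto
  note up = winding_up[OF curl far] and right = winding_right[of _ M G]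
  from d consider "d = (1, 0)" | "d = (0, 1)" | "d = (-1, 0)" | "d = (0, -1)"
    by (auto simp: unit_vectors_def)
  then have "winding G M (fst (y + d)) (snd (y + d)) = winding G M a b"
  proof cases
    case 1
    then show ?thesis using right[of a b] aM y by (simp add: ab hflux_def G_iff)
  next
    case 2
    then show ?thesis using up[of a b] aM y by (simp add: ab vflux_def G_iff)
  next
    case 3
    then show ?thesis using right[of "a - 1" b] aM y by (simp add: ab hflux_def G_iff)
  next
    case 4
    then show ?thesis using up[of a "b - 1"] aM y by (simp add: ab vflux_def G_iff)
  qed
  then show "winding G M (fst (y + d)) (snd (y + d)) = winding G M (fst x) (snd x)"
    using IH ab by simp
qed simp

text \<open>Heights change by at most one per step, so a connected set cannot jump over a
  row.\<close>

lemma row_meets: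
  assumes conn: "lattice_connected C (0, 0)" and "(0, 0) \<in> C" "(0, k) \<in> C" and b: "0 \<le> b" "b \<le> k"
  shows "\<exists>a. (a, b) \<in> C"
proof (rule ccontr)
  assume none: "\<nexists>a. (a, b) \<in> C"
  have "snd (0::int, k) < b"
  proof (rule lattice_connectedD[OF conn, where P = "\<lambda>y. snd y < b"])
    have "b \<noteq> 0" using none assms(2) by auto
    then show "snd (0::int, 0::int) < b" using b by simp
  next
    fix y d assume "snd y < b" "d \<in> unit_vectors" "y + d \<in> C"
    moreover from this have "snd (y + d) \<noteq> b" using none by (metis prod.collapse)
    ultimately show "snd (y + d) < b" by (auto simp: unit_vectors_def)
  qed (fact)
  then show False using b by simp
qed

text \<open>This makes the contour long. On the axis the winding number is 0 above
  \<open>(0, k)\<close> and jumps to 1 at \<open>(0, k)\<close> because of the start dart. Being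
  constant on \<open>C\<close>, it is 1 at some point of \<open>C\<close> in every row from 0 to
  \<open>k\<close>, and the ray from that point must cross the contour within its own row.\<close>

lemma contour_meets_rows:
  assumes fin: "finite C" and conn: "lattice_connected C (0, 0)"
    and 0: "(0, 0) \<in> C" and k: "(0, k) \<in> C" and top: "\<And>j. k < j \<Longrightarrow> (0, j) \<notin> C"
    and G: "G \<subseteq> boundary C" and perm: "next_dart C ` G = G" and start: "((0, k), (0, 1)) \<in> G"
  shows "{0..k} \<subseteq> (snd \<circ> fst) ` G"
proof
  fix b assume b: "b \<in> {0..k}"
  have finG: "finite G" using finite_subset[OF G finite_boundary[OF fin]] .
  have G_iff: "(p, e) \<notin> G" if "p \<notin> C \<or> p + e \<in> C" for p e
    using that G by (auto simp: boundary_def)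
  define M where "M = Max (fst ` C) + 1"
  have M: "a < M" if "(a, b) \<in> C" for a b
    using Max_ge[OF finite_imageI[OF fin], of a fst] imageI[OF that, of fst] by (simp add: M_def)
  have "(a, b) \<notin> C" if "M < a" for a b
    using M[of a b] that by auto
  then have far: "vflux G (M + 1) b = 0" for b
    by (simp add: vflux_def G_iff)
  have "0 < M" using M[OF 0] .
  note up = winding_up[OF flux_curl_free[OF finG G perm] far, of 0]
  define T where "T = max (k + 1) (Max (snd ` C) + 1)"
  have T: "(a, j) \<notin> C" if "T \<le> j" for a j
    using Max_ge[OF finite_imageI[OF fin], of j snd] imageI[of "(a, j)" C snd] that
    by (auto simp: T_def)
  have "winding G M 0 T = 0"
    using T by (auto simp: winding_def hflux_def G_iff)
  have "k + 1 \<le> T" by (simp add: T_def)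
  \<comment> \<open>Descend along the axis from row \<open>T\<close>, which lies above all of
    \<open>C\<close>. The guard \<open>k < i\<close> keeps the induction where no vertex of the axis
    belongs to \<open>C\<close>, so that no flux crosses the axis edges.\<close>
  then have "k < k + 1 \<longrightarrow> winding G M 0 (k + 1) = 0"
  proof (rule int_le_induct[where P = "\<lambda>i. k < i \<longrightarrow> winding G M 0 i = 0"])
    show "k < T \<longrightarrow> winding G M 0 T = 0" using \<open>winding G M 0 T = 0\<close> by simp
  next
    fix i assume step: "k < i \<longrightarrow> winding G M 0 i = 0"
    show "k < i - 1 \<longrightarrow> winding G M 0 (i - 1) = 0"
    proof
      assume "k < i - 1"
      then have "vflux G 0 (i - 1) = 0" using top by (simp add: vflux_def G_iff)
      then show "winding G M 0 (i - 1) = 0"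
        using up[of "i - 1"] \<open>0 < M\<close> step \<open>k < i - 1\<close> by simp
    qed
  qed
  then have "winding G M 0 (k + 1) = 0" by simp
  then have "winding G M 0 k = 1"
    using up[of k] \<open>0 < M\<close> start top[of "k + 1"] by (simp add: vflux_def G_iff)
  obtain a where a: "(a, b) \<in> C" using row_meets[OF conn 0 k] b by auto
  have "winding G M a b = 1"
    using winding_constant[OF fin conn G perm M a] winding_constant[OF fin conn G perm M k]
      \<open>winding G M 0 k = 1\<close> by simp
  then have "\<exists>j. hflux G j b \<noteq> 0"
    unfolding winding_def by (metis sum.neutral zero_neq_one)
  then obtain j where "((j, b), (1, 0)) \<in> G \<or> ((j + 1, b), (-1, 0)) \<in> G"
    by (auto simp: hflux_def of_bool_def split: if_splits)
  then show "b \<in> (snd \<circ> fst) ` G"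
    by (metis comp_apply fst_conv image_eqI snd_conv)
qed

section \<open>Closed contours and their pivots\<close>

text \<open>On a finite boundary the injective \<open>next_dart\<close> is a permutation of the
  orbit of the start dart. This orbit visits \<open>k + 1\<close> rows, so it has more than
  \<open>k\<close> darts and its first \<open>k + 1\<close> iterates are distinct.\<close>

lemma contour_walk:
  assumes fin: "finite C" and conn: "lattice_connected C (0, 0)"
    and 0: "(0, 0) \<in> C" and k: "(0, int k) \<in> C" and top: "\<And>j. int k < j \<Longrightarrow> (0, j) \<notin> C"
  shows "\<exists>ms. length ms = k \<and> distinct (walk ((0, int k), (0, 1)) ms) \<and>
    set (walk ((0, int k), (0, 1)) ms) \<subseteq> boundary C"
proof -
  define p where "p i = (next_dart C ^^ i) ((0, int k), (0, 1))" for i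
  have p_Suc: "p (Suc i) = next_dart C (p i)" for i by (simp add: p_def)
  define G where "G = range p"
  have p_boundary: "p i \<in> boundary C" for i
  proof (induction i)
    case 0
    show ?case using k top[of "int k + 1"] by (simp add: p_def boundary_def unit_vectors_def)
  qed (simp add: p_Suc next_dart_boundary)
  then have G: "G \<subseteq> boundary C" by (auto simp: G_def)
  have finG: "finite G" using finite_subset[OF G finite_boundary[OF fin]] .
  have perm: "next_dart C ` G = G"
  proof (rule endo_inj_surj[OF finG])
    show "next_dart C ` G \<subseteq> G" by (auto simp: G_def p_Suc[symmetric])
    show "inj_on (next_dart C) G" by (rule inj_on_subset[OF inj_on_next_dart G])
  qed
  have "p 0 \<in> G" by (simp add: G_def)
  then have "{0..int k} \<subseteq> (snd \<circ> fst) ` G"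
    using contour_meets_rows[OF fin conn 0 k top G perm] by (simp add: p_def)
  then have "card {0..int k} \<le> card G"
    by (meson card_image_le card_mono finG finite_imageI order_trans)
  then have card_G: "k < card G" by simp
  \<comment> \<open>A repetition at time \<open>j\<close> would trap the orbit among its first
    \<open>j\<close> darts, fewer than it contains.\<close>
  have neq: "p i \<noteq> p j" if "i < j" "j \<le> k" for i j
  proof
    assume eq: "p i = p j"
    have "p n \<in> p ` {..<j}" for n
    proof (induction n)
      case 0
      show ?case using that by auto
    next
      case (Suc n)
      then obtain l where l: "l < j" "p n = p l" by auto
      then have "p (Suc n) = p (Suc l)" by (simp add: p_Suc)
      then have "p (Suc n) = p (if Suc l = j then i else Suc l)" using eq by auto
      moreover have "(if Suc l = j then i else Suc l) < j" using l that by auto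
      ultimately show ?case by blast
    qed
    then have "card G \<le> card {..<j}"
      unfolding G_def by (intro surj_card_le) auto
    then show False using card_G that by simp
  qed
  have inj: "inj_on p {0..<Suc k}"
  proof (rule inj_onI)
    fix i j assume "i \<in> {0..<Suc k}" "j \<in> {0..<Suc k}" "p i = p j"
    then show "i = j" using neq[of i j] neq[of j i] by (cases i j rule: linorder_cases) auto
  qed
  have walk_eq: "walk (p i) (map (\<lambda>i. next_turn C (p i)) [i..<i + n]) = map p [i..<Suc (i + n)]" for i n
  proof (induction n arbitrary: i)
    case (Suc n)
    have "[i..<i + Suc n] = i # [Suc i..<Suc i + n]" by (simp add: upt_rec)
    moreover have "[i..<Suc (i + Suc n)] = i # [Suc i..<Suc (Suc i + n)]" by (simp add: upt_rec)
    moreover have "turn_dart (next_turn C (p i)) (p i) = p (Suc i)"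
      by (simp add: p_Suc next_dart_def)
    ultimately show ?case using Suc[of "Suc i"] by simp
  qed simp
  have "walk ((0, int k), (0, 1)) (map (\<lambda>i. next_turn C (p i)) [0..<k]) = map p [0..<Suc k]"
    using walk_eq[of 0 k] by (simp add: p_def)
  then show ?thesis
    using inj p_boundary by (intro exI[of _ "map (\<lambda>i. next_turn C (p i)) [0..<k]"])
      (auto simp: distinct_map simp del: upt_Suc)
qed

section \<open>Why an edge is closed: pivots and labels\<close>

definition star :: "vertex \<Rightarrow> edge set" where
  "star v = {f \<in> lattice_edges. v \<in> f}"

lemma star_eq: "star v = (\<lambda>d. {v, v + d}) ` unit_vectors"
proof
  show "star v \<subseteq> (\<lambda>d. {v, v + d}) ` unit_vectors"
  proof
    fix f assume "f \<in> star v"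
    then obtain a b where ab: "f = {a, b}" "\<bar>fst a - fst b\<bar> + \<bar>snd a - snd b\<bar> = 1"
      unfolding star_def lattice_edges_def by blast
    define w where "w = (if v = a then b else a)"
    have f: "f = {v, w}" and "\<bar>fst v - fst w\<bar> + \<bar>snd v - snd w\<bar> = 1"
      using ab \<open>f \<in> star v\<close> by (auto simp: star_def w_def)
    then have "w - v \<in> unit_vectors"
      by (cases v; cases w) (auto simp: unit_vectors_def)
    then show "f \<in> (\<lambda>d. {v, v + d}) ` unit_vectors"
      using f by (intro image_eqI[of _ _ "w - v"]) auto
  qed
  show "(\<lambda>d. {v, v + d}) ` unit_vectors \<subseteq> star v"
    using dart_edge_lattice[of "(v, _)"] by (auto simp: star_def)
qed

lemma finite_star [simp]: "finite (star v)"
  by (simp add: star_eq unit_vectors_def)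

lemma card_star [simp]: "card (star v) = 4"
proof -
  have "inj_on (\<lambda>d. {v, v + d}) unit_vectors"
    by (auto simp: inj_on_def doubleton_eq_iff)
  then show ?thesis by (simp add: star_eq card_image) (simp add: unit_vectors_def)
qed

text \<open>\<open>Inner\<close> and \<open>Outer\<close> name the saturated endpoint to the left
  and to the right of the walker, that is, inside and outside the finite set; the \<open>Bad\<close>
  labels do the same for an endpoint with a wrong constraint.\<close>

datatype label = Inner | Outer | Late | Bad_Inner | Bad_Outer

fun pivot :: "dart \<times> label \<Rightarrow> vertex" where
  "pivot ((x, d), l) = (if l = Inner \<or> l = Bad_Inner then x else x + d)"

text \<open>The possible reasons for the edge of a dart to be closed at time \<open>t\<close>, given that all edges in \<open>Q\<close>
  are closed: an endpoint has degree three and the edge rang last there, so that the other three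
  edges at this endpoint are open and hence not in \<open>Q\<close>; or the edge rings after time \<open>t\<close>; or an
  endpoint has constraint other than three.\<close>

fun explains :: "(edge \<Rightarrow> real) \<Rightarrow> (vertex \<Rightarrow> nat) \<Rightarrow> real \<Rightarrow> edge set \<Rightarrow> dart \<times> label \<Rightarrow> bool" where
  "explains U \<kappa> t Q (p, l) \<longleftrightarrow>
     (if l = Inner \<or> l = Outer then
        \<forall>f\<in>star (pivot (p, l)) - {dart_edge p}. U f < U (dart_edge p) \<and> f \<notin> Q
      else if l = Late then t < U (dart_edge p) else \<kappa> (pivot (p, l)) \<noteq> 3)"

text \<open>The edge \<open>e\<close> cannot be open before its own clock rings, so a degree of at
  least three at that time uses up the other three edges of the star.\<close>

lemma full_vertex:
  assumes wf: "wf (earlier U)" and e: "e \<in> star v"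
    and deg: "3 \<le> deg_before (cdp_config U \<kappa>) v (U e)" and f: "f \<in> star v - {e}"
  shows "U f < U e \<and> cdp_config U \<kappa> (U e) f"
proof -
  let ?D = "{f \<in> lattice_edges. v \<in> f \<and> (\<exists>r<U e. cdp_config U \<kappa> r f)}"
  have "?D \<subseteq> star v - {e}"
    using e cdp_config_eq[OF wf, of e] by (fastforce simp: star_def)
  moreover have "card (star v - {e}) = 3"
    using e by simp
  ultimately have "?D = star v - {e}"
    using deg by (intro card_seteq) (auto simp: deg_before_def)
  then obtain r where "r < U e" "cdp_config U \<kappa> r f" and "f \<in> lattice_edges"
    using f by blast
  then show ?thesis
    using cdp_config_eq[OF wf, of f] by auto
qed

text \<open>If the edge rang in time and both constraints are three, its attempt failed at an
  endpoint of degree at least three. By \<open>full_vertex\<close> the other edges there are open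
  when it rings, hence also at time \<open>t\<close>, and so outside \<open>Q\<close>.\<close>

lemma closed_explained:
  assumes wf: "wf (earlier U)" and p: "snd p \<in> unit_vectors"
    and closed: "\<not> cdp_config U \<kappa> t (dart_edge p)" and Q: "\<And>f. f \<in> Q \<Longrightarrow> \<not> cdp_config U \<kappa> t f"
  shows "\<exists>l. explains U \<kappa> t Q (p, l)"
proof -
  obtain x d where pxd: "p = (x, d)" by (metis surj_pair)
  let ?e = "dart_edge p"
  have e: "?e \<in> lattice_edges" using p by (rule dart_edge_lattice)
  have full: "\<forall>f\<in>star v - {?e}. U f < U ?e \<and> f \<notin> Q"
    if "U ?e \<le> t" "v \<in> ?e" "\<not> deg_before (cdp_config U \<kappa>) v (U ?e) < \<kappa> v" "\<kappa> v = 3" for v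
  proof
    fix f assume f: "f \<in> star v - {?e}"
    have "U f < U ?e \<and> cdp_config U \<kappa> (U ?e) f"
      using that e by (intro full_vertex[OF wf _ _ f]) (auto simp: star_def)
    moreover from this have "cdp_config U \<kappa> t f"
      using that(1) f cdp_config_eq[OF wf, of f] by (auto simp: star_def)
    ultimately show "U f < U ?e \<and> f \<notin> Q" using Q by blast
  qed
  consider "t < U ?e" | "\<kappa> x \<noteq> 3" | "\<kappa> (x + d) \<noteq> 3"
    | "U ?e \<le> t" "\<kappa> x = 3" "\<kappa> (x + d) = 3" by linarith
  then show ?thesis
  proof cases
    case 1 then show ?thesis by (intro exI[of _ Late]) simp
  next
    case 2 then show ?thesis by (intro exI[of _ Bad_Inner]) (simp add: pxd)
  next
    case 3 then show ?thesis by (intro exI[of _ Bad_Outer]) (simp add: pxd)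
  next
    case 4
    then obtain v where v: "v \<in> ?e" "\<not> deg_before (cdp_config U \<kappa>) v (U ?e) < \<kappa> v"
      using closed cdp_config_eq[OF wf e] by blast
    then have "v = x \<or> v = x + d" by (simp add: pxd)
    then show ?thesis
    proof
      assume "v = x"
      then show ?thesis using full[OF 4(1) v] 4 by (intro exI[of _ Inner]) (simp add: pxd)
    next
      assume "v = x + d"
      then show ?thesis using full[OF 4(1) v] 4 by (intro exI[of _ Outer]) (simp add: pxd)
    qed
  qed
qed

definition compatible :: "label \<Rightarrow> turn \<Rightarrow> label \<Rightarrow> bool" where
  "compatible l m l' \<longleftrightarrow>
     (m = Left \<longrightarrow> l \<noteq> Inner \<and> l' \<noteq> Inner) \<and> (m = Right \<longrightarrow> l \<noteq> Outer \<and> l' \<noteq> Outer)"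

text \<open>Two consecutive edges of a contour share the endpoint on the inside of the turn, so this endpoint
  cannot be one whose other three edges are open.\<close>

lemma explains_compatible:
  assumes "explains U \<kappa> t Q (p, l)" "explains U \<kappa> t Q (turn_dart m p, l')"
    and "dart_edge p \<in> Q" "dart_edge (turn_dart m p) \<in> Q" "dart_edge p \<noteq> dart_edge (turn_dart m p)"
    and unit: "snd p \<in> unit_vectors"
  shows "compatible l m l'"
proof -
  obtain x d where p: "p = (x, d)" by (metis surj_pair)
  have lat: "dart_edge p \<in> lattice_edges" "dart_edge (turn_dart m p) \<in> lattice_edges"
    using unit by (auto intro!: dart_edge_lattice turn_dart_unit)
  show ?thesis
    unfolding compatible_def
  proof (intro conjI impI notI)
    assume "m = Left" "l = Inner"
    then show False using assms lat by (auto simp: p star_def)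
  next
    assume "m = Left" "l' = Inner"
    then show False using assms lat by (auto simp: p star_def)
  next
    assume "m = Right" "l = Outer"
    then show False using assms lat by (auto simp: p star_def add_ac)
  next
    assume "m = Right" "l' = Outer"
    then show False using assms lat by (auto simp: p star_def add_ac)
  qed
qed

fun labelled_walk :: "dart \<Rightarrow> label \<Rightarrow> (turn \<times> label) list \<Rightarrow> (dart \<times> label) list" where
  "labelled_walk p l [] = [(p, l)]"
| "labelled_walk p l ((m, l') # xs) = (p, l) # labelled_walk (turn_dart m p) l' xs"

fun labellings :: "label \<Rightarrow> nat \<Rightarrow> (turn \<times> label) list set" where
  "labellings l 0 = {[]}"
| "labellings l (Suc n) = (\<Union>(m, l')\<in>{(m, l'). compatible l m l'}. (#) (m, l') ` labellings l' n)"

lemma walk_nonempty: "p \<in> set (walk p ms)"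
  by (cases ms) auto

text \<open>Labels chosen separately for each edge are automatically compatible along the walk,
  because every walk edge lies in \<open>Q\<close>.\<close>

lemma labelling_exists:
  assumes "distinct (map dart_edge (walk p ms))" "snd p \<in> unit_vectors"
    and "\<And>q. q \<in> set (walk p ms) \<Longrightarrow> dart_edge q \<in> Q \<and> explains U \<kappa> t Q (q, lab q)"
  shows "\<exists>xs\<in>labellings (lab p) (length ms).
    labelled_walk p (lab p) xs = map (\<lambda>q. (q, lab q)) (walk p ms)"
  using assms
proof (induction ms arbitrary: p)
  case (Cons m ms)
  let ?q = "turn_dart m p"
  have "\<exists>xs\<in>labellings (lab ?q) (length ms).
      labelled_walk ?q (lab ?q) xs = map (\<lambda>q. (q, lab q)) (walk ?q ms)"
  proof (rule Cons.IH)
    show "dart_edge q \<in> Q \<and> explains U \<kappa> t Q (q, lab q)" if "q \<in> set (walk ?q ms)" for q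
      using Cons.prems(3)[of q] that by simp
  qed (use Cons.prems(1,2) in \<open>auto intro!: turn_dart_unit\<close>)
  then obtain xs where xs: "xs \<in> labellings (lab ?q) (length ms)"
    "labelled_walk ?q (lab ?q) xs = map (\<lambda>q. (q, lab q)) (walk ?q ms)" by blast
  have q: "?q \<in> set (walk ?q ms)" by (rule walk_nonempty)
  have "compatible (lab p) m (lab ?q)"
  proof (rule explains_compatible[of U \<kappa> t Q])
    show "dart_edge p \<noteq> dart_edge ?q" using Cons.prems(1) q by auto
    show "explains U \<kappa> t Q (p, lab p)" "dart_edge p \<in> Q"
      using Cons.prems(3)[of p] by simp_all
    show "explains U \<kappa> t Q (?q, lab ?q)" "dart_edge ?q \<in> Q"
      using Cons.prems(3)[of ?q] q by simp_all
  qed (rule Cons.prems(2))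
  then show ?case using xs by (intro bexI[of _ "(m, lab ?q) # xs"]) force+
qed simp

section \<open>From finite clusters to an explained contour\<close>

abbreviation walk_edges :: "(dart \<times> label) list \<Rightarrow> edge set" where
  "walk_edges W \<equiv> dart_edge ` fst ` set W"

text \<open>Consecutive axis vertices are lattice neighbours whether or not the edge between them is
  open; this joins the clusters into one connected set.\<close>

lemma lattice_connected_clusters:
  assumes C: "C = (\<Union>b\<in>{0..N}. open_cluster \<omega> (0, b))"
  shows "lattice_connected C (0, 0)"
  unfolding lattice_connected_def
proof (intro allI impI, elim conjE)
  fix A :: "vertex set"
  assume 0: "(0, 0) \<in> A" and step: "\<forall>y\<in>A. \<forall>d\<in>unit_vectors. y \<in> C \<longrightarrow> y + d \<in> C \<longrightarrow> y + d \<in> A"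
  have axis_C: "(0, b) \<in> C" if "0 \<le> b" "b \<le> N" for b
    using that by (auto simp: C open_cluster_def)
  have "b \<le> N \<longrightarrow> (0, b) \<in> A" if "0 \<le> b" for b
    using that
  proof (induction b rule: int_ge_induct)
    case (step i)
    then show ?case
      using \<open>\<forall>y\<in>A. \<forall>d\<in>unit_vectors. y \<in> C \<longrightarrow> y + d \<in> C \<longrightarrow> y + d \<in> A\<close>[rule_format, of "(0, i)" "(0, 1)"]
        axis_C[of i] axis_C[of "i + 1"] by (auto simp: unit_vectors_def)
  qed (simp add: 0)
  then have axis: "(0, b) \<in> A" if "0 \<le> b" "b \<le> N" for b using that by blast
  show "C \<subseteq> A"
  proof
    fix y assume "y \<in> C"
    then obtain b where b: "0 \<le> b" "b \<le> N"
      and y: "((0, b), y) \<in> {(u, v). {u, v} \<in> lattice_edges \<and> \<omega> {u, v}}\<^sup>*"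
      by (auto simp: C open_cluster_def)
    from y show "y \<in> A"
    proof (induction rule: rtrancl_induct)
      case base
      show ?case using axis b by blast
    next
      case (step y z)
      have yz: "y \<in> C" "z \<in> C"
        using step.hyps b rtrancl_into_rtrancl[OF step.hyps] by (auto simp: C open_cluster_def)
      have "{y, z} \<in> star y" using step.hyps by (auto simp: star_def)
      then obtain d where "d \<in> unit_vectors" "{y, z} = {y, y + d}" by (auto simp: star_eq)
      moreover from this have "z = y + d" by (auto simp: doubleton_eq_iff)
      ultimately show ?case using \<open>\<forall>y\<in>A. \<forall>d\<in>unit_vectors. _\<close> step.IH yz by blast
    qed
  qed
qed

text \<open>The deterministic half of the Peierls argument. The contour starts above the highest
  axis vertex \<open>(0, k)\<close> in the union of the clusters, where \<open>k\<close> may exceed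
  \<open>N\<close>. All edges leaving this union are closed, as an open one would enlarge a cluster.
  The set \<open>Q\<close> of edges known to be closed is the contour itself.\<close>

lemma finite_clusters_contour:
  assumes wf: "wf (earlier U)"
    and fin: "\<And>b. 0 \<le> b \<Longrightarrow> b \<le> int N \<Longrightarrow> finite (open_cluster (cdp_config U \<kappa> t) (0, b))"
  shows "\<exists>k\<ge>N. \<exists>l. \<exists>xs\<in>labellings l k. let W = labelled_walk ((0, int k), (0, 1)) l xs in
    distinct (map (dart_edge \<circ> fst) W) \<and> (\<forall>w\<in>set W. explains U \<kappa> t (walk_edges W) w)"
proof -
  let ?\<omega> = "cdp_config U \<kappa> t"
  define C where "C = (\<Union>b\<in>{0..int N}. open_cluster ?\<omega> (0, b))"
  have finC: "finite C" using fin by (auto simp: C_def)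
  have axis: "(0, b) \<in> C" if "0 \<le> b" "b \<le> int N" for b
    using that by (auto simp: C_def open_cluster_def)
  define K where "K = {j. (0, j) \<in> C}"
  have "K \<subseteq> snd ` C" by (force simp: K_def)
  then have finK: "finite K" using finC finite_subset by blast
  have "int N \<in> K" using axis by (simp add: K_def)
  then have "int N \<le> Max K" "Max K \<in> K" using finK by (auto intro: Max_in)
  then obtain k where k: "Max K = int k" "N \<le> k" by (metis nonneg_int_cases of_nat_0_le_iff of_nat_le_iff order_trans)
  have kC: "(0, int k) \<in> C" using \<open>Max K \<in> K\<close> k by (simp add: K_def)
  have top: "(0, j) \<notin> C" if "int k < j" for j
  proof
    assume "(0, j) \<in> C"
    then have "j \<le> Max K" using finK by (intro Max_ge) (simp_all add: K_def)
    then show False using that k by simp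
  qed
  let ?p = "((0, int k), (0, 1)) :: dart"
  obtain ms where ms: "length ms = k" "distinct (walk ?p ms)" "set (walk ?p ms) \<subseteq> boundary C"
    using contour_walk[OF finC lattice_connected_clusters[OF C_def] _ kC top] axis by auto
  have closed: "\<not> ?\<omega> (dart_edge q)" if "q \<in> boundary C" for q
  proof
    assume "?\<omega> (dart_edge q)"
    obtain x d where q: "q = (x, d)" by (metis surj_pair)
    have "dart_edge q \<in> lattice_edges"
      using that by (intro dart_edge_lattice) (auto simp: boundary_def)
    moreover have "x \<in> C" using that by (simp add: boundary_def q)
    then obtain b where "b \<in> {0..int N}" "x \<in> open_cluster ?\<omega> (0, b)"
      unfolding C_def by blast
    ultimately have "x + d \<in> C"
      using \<open>?\<omega> (dart_edge q)\<close> by (auto simp: C_def q open_cluster_def intro: rtrancl_into_rtrancl)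
    then show False using that by (simp add: boundary_def q)
  qed
  define Q where "Q = dart_edge ` set (walk ?p ms)"
  have "\<forall>q. \<exists>l. q \<in> set (walk ?p ms) \<longrightarrow> explains U \<kappa> t Q (q, l)"
  proof
    fix q
    have "\<exists>l. explains U \<kappa> t Q (q, l)" if "q \<in> set (walk ?p ms)"
      using that ms(3) closed
      by (intro closed_explained[OF wf]) (auto simp: Q_def boundary_def)
    then show "\<exists>l. q \<in> set (walk ?p ms) \<longrightarrow> explains U \<kappa> t Q (q, l)" by blast
  qed
  then obtain lab where lab: "\<And>q. q \<in> set (walk ?p ms) \<Longrightarrow> explains U \<kappa> t Q (q, lab q)"
    by metis
  have dist: "distinct (map dart_edge (walk ?p ms))"
    using ms(2) inj_on_subset[OF inj_on_dart_edge ms(3)] by (simp add: distinct_map)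
  obtain xs where xs: "xs \<in> labellings (lab ?p) k"
    "labelled_walk ?p (lab ?p) xs = map (\<lambda>q. (q, lab q)) (walk ?p ms)"
    using labelling_exists[OF dist, of Q U \<kappa> t lab] lab ms(1)
    by (auto simp: Q_def unit_vectors_def)
  have "walk_edges (labelled_walk ?p (lab ?p) xs) = Q"
    by (simp add: xs(2) Q_def image_image)
  then show ?thesis
    using xs k dist lab
    by (intro exI[of _ k] conjI exI[of _ "lab ?p"] bexI[of _ xs]) (auto simp: Let_def comp_def)
qed

section \<open>Clocks exceeding their neighbours\<close>

abbreviation unif :: "real measure" where
  "unif \<equiv> uniform_measure lborel {0..1}"

lemma prob_space_unif: "prob_space unif"
  by (rule prob_space_uniform_measure) auto

lemma sets_unif [measurable_cong]: "sets unif = sets borel"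
  by simp

lemma nn_integral_unif:
  "f \<in> borel_measurable borel \<Longrightarrow> (\<integral>\<^sup>+x. f x \<partial>unif) = (\<integral>\<^sup>+x. f x * indicator {0..1} x \<partial>lborel)"
  by (subst nn_integral_uniform_measure) (auto simp: divide_ennreal_def)

lemma emeasure_unif: "A \<in> sets borel \<Longrightarrow> emeasure unif A = emeasure lborel ({0..1} \<inter> A)"
  by (subst emeasure_uniform_measure) (auto simp: divide_ennreal_def)

lemma emeasure_unif_lessThan: "u \<in> {0..1} \<Longrightarrow> emeasure unif {..<u} = ennreal u"
proof -
  assume u: "u \<in> {0..1}"
  then have "{0..1} \<inter> {..<u} = {0..<u}" by auto
  then show ?thesis using u by (simp add: emeasure_unif divide_ennreal_def)
qed

lemma emeasure_unif_greaterThan: "t \<in> {0..1} \<Longrightarrow> emeasure unif {t<..} = ennreal (1 - t)"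
proof -
  assume t: "t \<in> {0..1}"
  then have "{0..1} \<inter> {t<..} = {t<..1}" by auto
  then show ?thesis using t by (simp add: emeasure_unif divide_ennreal_def)
qed

lemma AE_unif: "AE x in unif. x \<in> {0..1}"
  by (rule AE_uniform_measureI) auto

lemma nn_integral_unif_mono:
  assumes "\<And>x. x \<in> {0..1} \<Longrightarrow> f x \<le> g x"
  shows "(\<integral>\<^sup>+x. f x \<partial>unif) \<le> (\<integral>\<^sup>+x. g x \<partial>unif)"
  using AE_unif by (rule nn_integral_mono_AE[OF AE_mp]) (use assms in auto)

lemma nn_integral_min_cubed:
  assumes u: "u \<in> {0..1}"
  shows "(\<integral>\<^sup>+x. ennreal (min u x ^ 3) \<partial>unif) \<le> ennreal (u ^ 3 - 3 / 4 * u ^ 4)"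
proof -
  have "(\<integral>\<^sup>+x. ennreal (min u x ^ 3) \<partial>unif) =
      (\<integral>\<^sup>+x. ennreal (min u x ^ 3) * indicator {0..1} x \<partial>lborel)"
    by (rule nn_integral_unif) measurable
  \<comment> \<open>The two indicators overlap at \<open>x = u\<close>, hence only an
    inequality.\<close>
  also have "\<dots> \<le> (\<integral>\<^sup>+x. ennreal (x ^ 3) * indicator {0..u} x + ennreal (u ^ 3) * indicator {u..1} x \<partial>lborel)"
    using u by (intro nn_integral_mono) (auto split: split_indicator simp: min_def)
  also have "\<dots> = (\<integral>\<^sup>+x. ennreal (x ^ 3) * indicator {0..u} x \<partial>lborel) + ennreal (u ^ 3) * ennreal (1 - u)"
    using u by (subst nn_integral_add) (auto simp: nn_integral_cmult)
  also have "(\<integral>\<^sup>+x. ennreal (x ^ 3) * indicator {0..u} x \<partial>lborel) = ennreal (u ^ 4 / 4 - 0 ^ 4 / 4)"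
    using u by (intro nn_integral_FTC_Icc) (auto intro!: derivative_eq_intros)
  also have "\<dots> + ennreal (u ^ 3) * ennreal (1 - u) = ennreal (u ^ 3 - 3 / 4 * u ^ 4)"
    using u by (simp add: ennreal_mult[symmetric] ennreal_plus[symmetric] del: ennreal_plus)
      (simp add: power_numeral_reduce algebra_simps)
  finally show ?thesis .
qed

lemma nn_integral_min_cubed_twice:
  "(\<integral>\<^sup>+u. \<integral>\<^sup>+x. ennreal (min u x ^ 3) \<partial>unif \<partial>unif) \<le> ennreal (1 / 10)"
proof -
  have "(\<integral>\<^sup>+u. \<integral>\<^sup>+x. ennreal (min u x ^ 3) \<partial>unif \<partial>unif) \<le> (\<integral>\<^sup>+u. ennreal (u ^ 3 - 3 / 4 * u ^ 4) \<partial>unif)"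
    by (intro nn_integral_unif_mono nn_integral_min_cubed)
  also have "\<dots> = (\<integral>\<^sup>+u. ennreal (u ^ 3 - 3 / 4 * u ^ 4) * indicator {0..1} u \<partial>lborel)"
    by (rule nn_integral_unif) measurable
  also have "\<dots> = ennreal ((1 ^ 4 / 4 - 3 / 20 * 1 ^ 5) - (0 ^ 4 / 4 - 3 / 20 * 0 ^ 5))"
  proof (rule nn_integral_FTC_Icc[where F = "\<lambda>x. x ^ 4 / 4 - 3 / 20 * x ^ 5"])
    fix x :: real assume x: "x \<in> {0..1}"
    show "((\<lambda>x. x ^ 4 / 4 - 3 / 20 * x ^ 5) has_real_derivative x ^ 3 - 3 / 4 * x ^ 4) (at x)"
      by (auto intro!: derivative_eq_intros)
    have "x ^ 4 \<le> x ^ 3" using x by (intro power_decreasing) auto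
    moreover have "0 \<le> x ^ 4" by simp
    ultimately show "0 \<le> x ^ 3 - 3 / 4 * x ^ 4" by linarith
  qed auto
  also have "\<dots> = ennreal (1 / 10)" by simp
  finally show ?thesis .
qed

section \<open>Exceeding all clocks of a neighbourhood\<close>

definition below :: "'i set \<Rightarrow> ('i \<Rightarrow> real) \<Rightarrow> real \<Rightarrow> ennreal" where
  "below N y u = (\<Prod>f\<in>N. if y f < u then 1 else 0)"

lemma measurable_below:
  assumes N: "N \<subseteq> F"
    and g: "g \<in> M \<rightarrow>\<^sub>M PiM F (\<lambda>_. unif)" and h: "h \<in> M \<rightarrow>\<^sub>M unif"
  shows "(\<lambda>x. below N (g x) (h x)) \<in> borel_measurable M"
  unfolding below_def
proof (rule borel_measurable_prod_ennreal)
  fix f assume "f \<in> N"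
  then have "f \<in> F" using N by auto
  from measurable_compose[OF g measurable_component_singleton[OF this]]
  have [measurable]: "(\<lambda>x. g x f) \<in> borel_measurable M" "h \<in> borel_measurable M"
    using h by (simp_all only: measurable_cong_sets[OF refl sets_unif])
  show "(\<lambda>x. if g x f < h x then 1 else 0 :: ennreal) \<in> borel_measurable M"
    by measurable
qed

text \<open>Given the clocks \<open>y\<close>, the chance that a fresh clock rings after all those
  in \<open>N\<close>; for a nonempty finite \<open>N\<close> with clocks in the unit interval this
  is 1 minus their maximum.\<close>

definition exceed :: "'i set \<Rightarrow> ('i \<Rightarrow> real) \<Rightarrow> ennreal" where
  "exceed N y = (\<integral>\<^sup>+u. below N y u \<partial>unif)"

lemma measurable_exceed:
  assumes "N \<subseteq> F"
  shows "exceed N \<in> borel_measurable (PiM F (\<lambda>_. unif))"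
proof -
  interpret prob_space unif by (rule prob_space_unif)
  show ?thesis
    unfolding exceed_def[abs_def] by (rule borel_measurable_nn_integral)
      (auto simp: split_beta' intro!: measurable_below[OF assms])
qed

text \<open>Squaring introduces two independent copies \<open>u\<close> and \<open>x\<close>. Both
  exceed the three clocks exactly when these lie below \<open>min u x\<close>, so integrating over
  \<open>y\<close> first leaves the third power of the minimum.\<close>

lemma nn_integral_exceed_squared:
  assumes N: "finite N" "card N = 3"
  shows "(\<integral>\<^sup>+y. exceed N y ^ 2 \<partial>PiM N (\<lambda>_. unif)) \<le> ennreal (1 / 10)"
proof -
  interpret unif: prob_space unif by (rule prob_space_unif)
  interpret product_prob_space "\<lambda>_. unif" N by unfold_locales
  let ?P = "PiM N (\<lambda>_. unif)"
  interpret P: pair_sigma_finite ?P unif by unfold_locales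
  note meas = measurable_below[OF subset_refl, of _ _ N]
  note meas[measurable]
  have "(\<integral>\<^sup>+y. exceed N y ^ 2 \<partial>?P) = (\<integral>\<^sup>+y. (\<integral>\<^sup>+u. (\<integral>\<^sup>+x. below N y u * below N y x \<partial>unif) \<partial>unif) \<partial>?P)"
    unfolding exceed_def power2_eq_square
    by (intro nn_integral_cong) (simp add: nn_integral_cmult nn_integral_multc)
  also have "\<dots> = (\<integral>\<^sup>+u. (\<integral>\<^sup>+y. (\<integral>\<^sup>+x. below N y u * below N y x \<partial>unif) \<partial>?P) \<partial>unif)"
    by (rule P.Fubini'[symmetric]) measurable
  also have "\<dots> = (\<integral>\<^sup>+u. (\<integral>\<^sup>+x. (\<integral>\<^sup>+y. below N y u * below N y x \<partial>?P) \<partial>unif) \<partial>unif)"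
    by (intro nn_integral_cong P.Fubini'[symmetric]) measurable
  also have "\<dots> \<le> (\<integral>\<^sup>+u. (\<integral>\<^sup>+x. ennreal (min u x ^ 3) \<partial>unif) \<partial>unif)"
  proof (intro nn_integral_unif_mono)
    fix u x :: real assume u: "u \<in> {0..1}" and x: "x \<in> {0..1}"
    then have m: "min u x \<in> {0..1}" by auto
    have "(\<integral>\<^sup>+y. below N y u * below N y x \<partial>?P) = (\<integral>\<^sup>+y. (\<Prod>f\<in>N. indicator {..<min u x} (y f)) \<partial>?P)"
      by (intro nn_integral_cong)
        (auto simp: below_def prod.distrib[symmetric] indicator_def of_bool_def intro!: prod.cong)
    also have "\<dots> = (\<Prod>f\<in>N. emeasure unif {..<min u x})"
      using N(1) by (subst product_nn_integral_prod) auto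
    also have "\<dots> = ennreal (min u x ^ 3)"
      using N(2) emeasure_unif_lessThan[OF m] m by (simp add: ennreal_power del: emeasure_uniform_measure)
    finally show "(\<integral>\<^sup>+y. below N y u * below N y x \<partial>?P) \<le> ennreal (min u x ^ 3)" by simp
  qed
  also have "\<dots> \<le> ennreal (1 / 10)" by (rule nn_integral_min_cubed_twice)
  finally show ?thesis .
qed

text \<open>Functions of disjoint blocks of coordinates are independent. Measurability is asked over
  every index set containing the block, since the induction removes one block after another from
  \<open>F\<close>.\<close>

lemma nn_integral_prod_disjoint:
  fixes M :: "'i \<Rightarrow> 'a measure" and g :: "'j \<Rightarrow> ('i \<Rightarrow> 'a) \<Rightarrow> ennreal"
  assumes "\<And>i. prob_space (M i)" and "finite S" "finite F" "disjoint_family_on N S"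
    and "\<And>e. e \<in> S \<Longrightarrow> N e \<subseteq> F"
    and "\<And>e F. e \<in> S \<Longrightarrow> N e \<subseteq> F \<Longrightarrow> g e \<in> borel_measurable (PiM F M)"
    and "\<And>e y z. e \<in> S \<Longrightarrow> (\<And>i. i \<in> N e \<Longrightarrow> y i = z i) \<Longrightarrow> g e y = g e z"
  shows "(\<integral>\<^sup>+y. (\<Prod>e\<in>S. g e y) \<partial>PiM F M) = (\<Prod>e\<in>S. \<integral>\<^sup>+y. g e y \<partial>PiM (N e) M)"
  using assms(2-)
proof (induction S arbitrary: F rule: finite_induct)
  case empty
  interpret prob_space "PiM F M" by (rule prob_space_PiM) (rule assms(1))
  show ?case by (simp add: emeasure_space_1)
next
  case (insert e S)
  interpret M: prob_space "M i" for i by (rule assms(1))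
  interpret product_prob_space M F by unfold_locales
  let ?R = "F - N e"
  have N: "N e \<subseteq> F" by (rule insert.prems(3)) simp
  then have fin: "finite (N e)" using insert.prems(1) by (rule finite_subset)
  interpret Ne: prob_space "PiM (N e) M" by (rule prob_space_PiM) (rule assms(1))
  interpret R: prob_space "PiM ?R M" by (rule prob_space_PiM) (rule assms(1))
  have NR: "N e' \<subseteq> ?R" if "e' \<in> S" for e'
    using insert.prems(2,3) insert.hyps that by (auto simp: disjoint_family_on_def)
  have F: "F = N e \<union> ?R" using N by auto
  have meas: "(\<lambda>y. \<Prod>i\<in>insert e S. g i y) \<in> borel_measurable (PiM (N e \<union> ?R) M)"
    using insert.prems(3,4) F by (intro borel_measurable_prod_ennreal) auto
  have "(\<integral>\<^sup>+y. (\<Prod>i\<in>insert e S. g i y) \<partial>PiM F M) =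
      (\<integral>\<^sup>+y. (\<integral>\<^sup>+z. (\<Prod>i\<in>insert e S. g i (merge (N e) ?R (y, z))) \<partial>PiM ?R M) \<partial>PiM (N e) M)"
    by (subst F, subst product_nn_integral_fold) (use fin insert.prems(1) meas in auto)
  also have "\<dots> = (\<integral>\<^sup>+y. (\<integral>\<^sup>+z. g e y * (\<Prod>e\<in>S. g e z) \<partial>PiM ?R M) \<partial>PiM (N e) M)"
  proof (intro nn_integral_cong)
    fix y z
    have "g e (merge (N e) ?R (y, z)) = g e y"
      by (rule insert.prems(5)) auto
    moreover have "g e' (merge (N e) ?R (y, z)) = g e' z" if "e' \<in> S" for e'
      using that NR[OF that] by (intro insert.prems(5)) (auto simp: merge_def)
    ultimately show "(\<Prod>i\<in>insert e S. g i (merge (N e) ?R (y, z))) = g e y * (\<Prod>e\<in>S. g e z)"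
      using insert.hyps by simp
  qed
  also have "\<dots> = (\<integral>\<^sup>+y. g e y * (\<integral>\<^sup>+z. (\<Prod>e\<in>S. g e z) \<partial>PiM ?R M) \<partial>PiM (N e) M)"
    using insert.prems(4) NR by (intro nn_integral_cong nn_integral_cmult borel_measurable_prod_ennreal) auto
  also have "\<dots> = (\<integral>\<^sup>+y. g e y \<partial>PiM (N e) M) * (\<integral>\<^sup>+z. (\<Prod>e\<in>S. g e z) \<partial>PiM ?R M)"
    using insert.prems(4) by (intro nn_integral_multc) auto
  also have "(\<integral>\<^sup>+z. (\<Prod>e\<in>S. g e z) \<partial>PiM ?R M) = (\<Prod>e\<in>S. \<integral>\<^sup>+y. g e y \<partial>PiM (N e) M)"
  proof (rule insert.IH)
    show "finite ?R" using insert.prems(1) by simp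
    show "disjoint_family_on N S" using insert.prems(2) by (auto simp: disjoint_family_on_def)
    show "N i \<subseteq> ?R" if "i \<in> S" for i using that by (rule NR)
    show "g i \<in> borel_measurable (PiM F M)" if "i \<in> S" "N i \<subseteq> F" for i F
      using that by (intro insert.prems(4)) auto
    show "g i y = g i z" if "i \<in> S" "\<And>j. j \<in> N i \<Longrightarrow> y j = z j" for i y z
      using that by (intro insert.prems(5)) auto
  qed
  finally show ?case using insert.hyps by simp
qed

lemma exceed_cong: "(\<And>f. f \<in> N \<Longrightarrow> y f = z f) \<Longrightarrow> exceed N y = exceed N z"
  unfolding exceed_def below_def by (intro nn_integral_cong prod.cong) auto

lemma nn_integral_prod_exceed_squared:
  assumes "finite S" "finite F" "disjoint_family_on N S"
    and N: "\<And>e. e \<in> S \<Longrightarrow> N e \<subseteq> F" "\<And>e. e \<in> S \<Longrightarrow> card (N e) = 3"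
  shows "(\<integral>\<^sup>+y. (\<Prod>e\<in>S. exceed (N e) y) ^ 2 \<partial>PiM F (\<lambda>_. unif)) \<le> ennreal ((1 / 10) ^ card S)"
proof -
  have fin: "finite (N e)" if "e \<in> S" for e using N(1)[OF that] assms(2) by (rule finite_subset)
  have "(\<integral>\<^sup>+y. (\<Prod>e\<in>S. exceed (N e) y) ^ 2 \<partial>PiM F (\<lambda>_. unif)) =
      (\<integral>\<^sup>+y. (\<Prod>e\<in>S. exceed (N e) y ^ 2) \<partial>PiM F (\<lambda>_. unif))"
    by (simp add: prod_power_distrib)
  also have "\<dots> = (\<Prod>e\<in>S. \<integral>\<^sup>+y. exceed (N e) y ^ 2 \<partial>PiM (N e) (\<lambda>_. unif))"
    using assms fin
    by (intro nn_integral_prod_disjoint prob_space_unif)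
      (auto simp: power2_eq_square intro!: borel_measurable_times_ennreal measurable_exceed
        arg_cong2[where f = "(*)"] exceed_cong)
  also have "\<dots> \<le> (\<Prod>e\<in>S. ennreal (1 / 10))"
    using fin N(2) by (intro prod_mono_ennreal nn_integral_exceed_squared) auto
  also have "\<dots> = ennreal ((1 / 10) ^ card S)" by (simp add: ennreal_power)
  finally show ?thesis .
qed

text \<open>Cauchy--Schwarz separates the two colour classes; within a class the neighbourhoods are disjoint.\<close>

lemma emeasure_clocks:
  fixes L G T :: "'i set" and N :: "'i \<Rightarrow> 'i set" and col :: "'i \<Rightarrow> bool"
  assumes fin: "finite G" "finite T" and disj: "G \<inter> T = {}" and L: "G \<union> T \<subseteq> L"
    and N: "\<And>e. e \<in> G \<Longrightarrow> N e \<subseteq> L - (G \<union> T)" "\<And>e. e \<in> G \<Longrightarrow> card (N e) = 3"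
    and col: "\<And>e e'. e \<in> G \<Longrightarrow> e' \<in> G \<Longrightarrow> e \<noteq> e' \<Longrightarrow> col e = col e' \<Longrightarrow> N e \<inter> N e' = {}"
    and t: "t \<in> {0..1}"
  shows "(emeasure (PiM L (\<lambda>_. unif)) {U \<in> space (PiM L (\<lambda>_. unif)).
      (\<forall>e\<in>G. \<forall>f\<in>N e. U f < U e) \<and> (\<forall>e\<in>T. t < U e)})\<^sup>2 \<le> ennreal ((1 / 10) ^ card G * ((1 - t) ^ card T)\<^sup>2)"
proof -
  interpret unif: prob_space unif by (rule prob_space_unif)
  interpret product_prob_space "\<lambda>_. unif" L by unfold_locales
  define F where "F = (\<Union>e\<in>G. N e)"
  define A where "A = G \<union> T"
  let ?J = "F \<union> A" and ?m = "\<lambda>_::'i. unif"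
  let ?P = "\<lambda>U. (\<forall>e\<in>G. \<forall>f\<in>N e. U f < U e) \<and> (\<forall>e\<in>T. t < U e)"
  have finN: "finite (N e)" if "e \<in> G" for e using N(2)[OF that] card.infinite by fastforce
  then have finF: "finite F" and finA: "finite A" using fin by (auto simp: F_def A_def)
  have J: "finite ?J" "?J \<subseteq> L" using finF finA L N(1) by (auto simp: F_def A_def)
  \<comment> \<open>Neighbours never lie on the contour, so their clocks and those of the contour
    can be integrated one after the other.\<close>
  have FA: "F \<inter> A = {}" using N(1) by (auto simp: F_def A_def)
  have [measurable]: "finite G" "finite T" "\<And>e. e \<in> G \<Longrightarrow> finite (N e)" "\<And>e. e \<in> G \<Longrightarrow> e \<in> ?J"
    "\<And>e. e \<in> T \<Longrightarrow> e \<in> ?J" "\<And>e f. e \<in> G \<Longrightarrow> f \<in> N e \<Longrightarrow> f \<in> ?J"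
    using fin finN by (auto simp: A_def F_def)
  have meas: "{U \<in> space (PiM ?J ?m). ?P U} \<in> sets (PiM ?J ?m)"
    by measurable
  have "emeasure (PiM L ?m) {U \<in> space (PiM L ?m). ?P U} =
      emeasure (distr (PiM L ?m) (PiM ?J ?m) (\<lambda>x. restrict x ?J)) {U \<in> space (PiM ?J ?m). ?P U}"
  proof (subst emeasure_distr)
    show "(\<lambda>x. restrict x ?J) \<in> PiM L ?m \<rightarrow>\<^sub>M PiM ?J ?m"
      using J by (intro measurable_restrict_subset)
    have P: "?P (restrict U ?J) = ?P U" for U
      by (auto simp: F_def A_def)
    have "(\<lambda>x. restrict x ?J) -` {U \<in> space (PiM ?J ?m). ?P U} \<inter> space (PiM L ?m) =
        {U \<in> space (PiM L ?m). ?P (restrict U ?J)}"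
      using J by (auto simp: space_PiM)
    then show "emeasure (PiM L ?m) {U \<in> space (PiM L ?m). ?P U} =
      emeasure (PiM L ?m) ((\<lambda>x. restrict x ?J) -` {U \<in> space (PiM ?J ?m). ?P U} \<inter> space (PiM L ?m))"
      by (simp only: P)
  qed (rule meas)
  also have "\<dots> = emeasure (PiM ?J ?m) {U \<in> space (PiM ?J ?m). ?P U}"
    by (simp only: distr_PiM_restrict_finite[OF J])
  also have "\<dots> = (\<integral>\<^sup>+U. indicator {U \<in> space (PiM ?J ?m). ?P U} U \<partial>PiM ?J ?m)"
    using meas by simp
  also have "\<dots> = (\<integral>\<^sup>+y. (\<integral>\<^sup>+x. indicator {U \<in> space (PiM ?J ?m). ?P U} (merge F A (y, x)) \<partial>PiM A ?m) \<partial>PiM F ?m)"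
    using meas by (intro product_nn_integral_fold FA finF finA) auto
  \<comment> \<open>For fixed neighbour clocks \<open>y\<close> the event restricts each clock in
    \<open>A\<close> on its own, so its indicator is bounded by a product with one factor per
    element of \<open>A\<close>.\<close>
  also have "\<dots> \<le> (\<integral>\<^sup>+y. (\<integral>\<^sup>+x. (\<Prod>e\<in>A. if e \<in> G then below (N e) y (x e)
      else indicator {t<..} (x e)) \<partial>PiM A ?m) \<partial>PiM F ?m)"
  proof (intro nn_integral_mono)
    fix y x
    show "indicator {U \<in> space (PiM ?J ?m). ?P U} (merge F A (y, x)) \<le>
      (\<Prod>e\<in>A. if e \<in> G then below (N e) y (x e) else indicator {t<..} (x e) :: ennreal)"
    proof (cases "?P (merge F A (y, x))")
      case True
      have "merge F A (y, x) f = y f" if "e \<in> G" "f \<in> N e" for e f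
      proof -
        have "f \<in> F" using that by (auto simp: F_def)
        then show ?thesis using FA by auto
      qed
      moreover have "merge F A (y, x) e = x e" if "e \<in> A" for e
        using that FA by auto
      ultimately have "\<forall>e\<in>G. \<forall>f\<in>N e. y f < x e" "\<forall>e\<in>T. t < x e"
        using True by (auto simp: A_def)
      then have "(\<Prod>e\<in>A. if e \<in> G then below (N e) y (x e) else indicator {t<..} (x e) :: ennreal) = 1"
        by (intro prod.neutral) (auto simp: A_def below_def intro!: prod.neutral)
      then show ?thesis by (simp add: indicator_def)
    next
      case False
      then have "indicator {U \<in> space (PiM ?J ?m). ?P U} (merge F A (y, x)) = (0 :: ennreal)"
        by (intro indicator_simps(2)) blast
      then show ?thesis by (simp only: zero_le)
    qed
  qed
  also have "\<dots> = (\<integral>\<^sup>+y. (\<Prod>e\<in>A. if e \<in> G then exceed (N e) y else ennreal (1 - t)) \<partial>PiM F ?m)"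
  proof (intro nn_integral_cong)
    fix y
    let ?\<phi> = "\<lambda>e u. if e \<in> G then below (N e) y u else indicator {t<..} u :: ennreal"
    have "(\<integral>\<^sup>+x. (\<Prod>e\<in>A. ?\<phi> e (x e)) \<partial>PiM A ?m) = (\<Prod>e\<in>A. \<integral>\<^sup>+u. ?\<phi> e u \<partial>unif)"
    proof (rule product_nn_integral_prod[OF finA])
      fix e
      have "(\<lambda>u. below (N e) y u) \<in> borel_measurable unif"
        unfolding below_def by measurable
      then show "?\<phi> e \<in> borel_measurable unif" by simp
    qed
    also have "\<dots> = (\<Prod>e\<in>A. if e \<in> G then exceed (N e) y else ennreal (1 - t))"
      using emeasure_unif_greaterThan[OF t]
      by (intro prod.cong) (auto simp: exceed_def simp del: emeasure_uniform_measure)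
    finally show "(\<integral>\<^sup>+x. (\<Prod>e\<in>A. ?\<phi> e (x e)) \<partial>PiM A ?m) =
      (\<Prod>e\<in>A. if e \<in> G then exceed (N e) y else ennreal (1 - t))" .
  qed
  also have "\<dots> = (\<integral>\<^sup>+y. (\<Prod>e\<in>{e\<in>G. col e}. exceed (N e) y) * (\<Prod>e\<in>{e\<in>G. \<not> col e}. exceed (N e) y)
      * ennreal (1 - t) ^ card T \<partial>PiM F ?m)"
  proof (intro nn_integral_cong)
    fix y
    have "(\<Prod>e\<in>A. if e \<in> G then exceed (N e) y else ennreal (1 - t)) =
        (\<Prod>e\<in>G. exceed (N e) y) * (\<Prod>e\<in>T. ennreal (1 - t))"
      unfolding A_def prod.union_disjoint[OF fin disj]
      using disj by (intro arg_cong2[where f = "(*)"] prod.cong) auto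
    also have "(\<Prod>e\<in>G. exceed (N e) y) =
        (\<Prod>e\<in>{e\<in>G. col e} \<union> {e\<in>G. \<not> col e}. exceed (N e) y)"
      by (intro prod.cong) auto
    also have "\<dots> = (\<Prod>e\<in>{e\<in>G. col e}. exceed (N e) y) * (\<Prod>e\<in>{e\<in>G. \<not> col e}. exceed (N e) y)"
      using fin by (intro prod.union_disjoint) auto
    finally show "(\<Prod>e\<in>A. if e \<in> G then exceed (N e) y else ennreal (1 - t)) =
      (\<Prod>e\<in>{e\<in>G. col e}. exceed (N e) y) * (\<Prod>e\<in>{e\<in>G. \<not> col e}. exceed (N e) y)
      * ennreal (1 - t) ^ card T" by simp
  qed
  also have "\<dots> = (\<integral>\<^sup>+y. (\<Prod>e\<in>{e\<in>G. col e}. exceed (N e) y) * (\<Prod>e\<in>{e\<in>G. \<not> col e}. exceed (N e) y) \<partial>PiM F ?m)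
      * ennreal (1 - t) ^ card T" (is "_ = ?I * _")
    using finN by (intro nn_integral_multc borel_measurable_times_ennreal borel_measurable_prod_ennreal measurable_exceed)
      (auto simp: F_def)
  finally have le: "emeasure (PiM L ?m) {U \<in> space (PiM L ?m). ?P U} \<le> ?I * ennreal (1 - t) ^ card T" .
  \<comment> \<open>Neighbourhoods of different colours may overlap, so the two products can be
    dependent; the inequality decouples them at the price of squares.\<close>
  have "?I\<^sup>2 \<le> (\<integral>\<^sup>+y. (\<Prod>e\<in>{e\<in>G. col e}. exceed (N e) y)\<^sup>2 \<partial>PiM F ?m) *
      (\<integral>\<^sup>+y. (\<Prod>e\<in>{e\<in>G. \<not> col e}. exceed (N e) y)\<^sup>2 \<partial>PiM F ?m)"
    using finN by (intro Cauchy_Schwarz_nn_integral borel_measurable_prod_ennreal measurable_exceed)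
      (auto simp: F_def)
  also have "\<dots> \<le> ennreal ((1 / 10) ^ card {e\<in>G. col e}) * ennreal ((1 / 10) ^ card {e\<in>G. \<not> col e})"
    using fin finF N(2) col
    by (intro mult_mono nn_integral_prod_exceed_squared) (auto simp: disjoint_family_on_def F_def)
  also have "\<dots> = ennreal ((1 / 10) ^ card G)"
  proof -
    have "card G = card ({e\<in>G. col e} \<union> {e\<in>G. \<not> col e})" by (rule arg_cong[where f = card]) auto
    also have "\<dots> = card {e\<in>G. col e} + card {e\<in>G. \<not> col e}"
      using fin by (intro card_Un_disjoint) auto
    finally show ?thesis by (simp add: ennreal_mult[symmetric] power_add)
  qed
  finally have I: "?I\<^sup>2 \<le> ennreal ((1 / 10) ^ card G)" .
  \<comment> \<open>Keeping the bound squared avoids the root of \<open>1 / 10\<close>.\<close>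
  have "(emeasure (PiM L ?m) {U \<in> space (PiM L ?m). ?P U})\<^sup>2 \<le> (?I * ennreal (1 - t) ^ card T)\<^sup>2"
    using le by (intro power_mono) auto
  also have "\<dots> \<le> ennreal ((1 / 10) ^ card G) * ennreal (((1 - t) ^ card T)\<^sup>2)"
    using I t unfolding power_mult_distrib by (intro mult_mono) (auto simp: ennreal_power)
  also have "\<dots> = ennreal ((1 / 10) ^ card G * ((1 - t) ^ card T)\<^sup>2)"
    using t by (simp add: ennreal_mult)
  finally show ?thesis .
qed

section \<open>Counting labelled contours\<close>

text \<open>\<open>317 / 1000\<close> is slightly larger than \<open>1 / sqrt 10\<close>, and \<open>1 / 1000\<close> makes three times the former plus
  twelve times the latter smaller than \<open>97 / 100\<close>.\<close>

definition weight :: "label \<Rightarrow> real" where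
  "weight l = (if l = Inner \<or> l = Outer then 317 / 1000 else 1 / 1000)"

lemma weight_nonneg [simp]: "0 \<le> weight l"
  by (simp add: weight_def)

abbreviation walk_weight :: "('b \<times> label) list \<Rightarrow> real" where
  "walk_weight xs \<equiv> prod_list (map (weight \<circ> snd) xs)"

lemma walk_weight_nonneg [simp]: "0 \<le> walk_weight xs"
  by (induction xs) auto

lemma UNIV_turn: "UNIV = {Ahead, Left, Right}"
  using turn.exhaust by auto

lemma UNIV_label: "UNIV = {Inner, Outer, Late, Bad_Inner, Bad_Outer}"
  using label.exhaust by auto

lemma finite_labellings [simp]: "finite (labellings l n)"
proof (induction n arbitrary: l)
  case (Suc n)
  have "finite (UNIV :: (turn \<times> label) set)"
    by (subst UNIV_Times_UNIV[symmetric]) (simp add: UNIV_turn UNIV_label)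
  then have "finite {(m, l'). compatible l m l'}" by (rule rev_finite_subset) auto
  then show ?case using Suc by auto
qed simp

text \<open>Transfer recursion: once the first step is split off, the rest of the sum depends only
  on the next label.\<close>

lemma sum_labellings_Suc:
  "(\<Sum>xs\<in>labellings l (Suc n). walk_weight xs) =
    (\<Sum>m\<in>UNIV. \<Sum>l'\<in>UNIV. if compatible l m l'
      then weight l' * (\<Sum>xs\<in>labellings l' n. walk_weight xs) else 0)"
proof -
  let ?I = "{(m, l'). compatible l m l'}"
  have fin: "finite (UNIV :: turn set)" "finite (UNIV :: label set)"
    by (simp_all add: UNIV_turn UNIV_label)
  have finI: "finite ?I"
    by (rule finite_subset[OF subset_UNIV finite_Prod_UNIV[OF fin]])
  have eq: "labellings l (Suc n) = (\<lambda>(p, xs). p # xs) ` (SIGMA p:?I. labellings (snd p) n)"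
    by force
  have "(\<Sum>xs\<in>labellings l (Suc n). walk_weight xs) =
      (\<Sum>(p, xs)\<in>(SIGMA p:?I. labellings (snd p) n). weight (snd p) * walk_weight xs)"
    unfolding eq by (subst sum.reindex) (auto simp: inj_on_def intro!: sum.cong)
  also have "\<dots> = (\<Sum>p\<in>?I. weight (snd p) * (\<Sum>xs\<in>labellings (snd p) n. walk_weight xs))"
    using finI by (subst sum.Sigma[symmetric]) (auto simp: sum_distrib_left)
  also have "\<dots> = (\<Sum>p\<in>UNIV \<times> UNIV. if compatible l (fst p) (snd p)
      then weight (snd p) * (\<Sum>xs\<in>labellings (snd p) n. walk_weight xs) else 0)"
    using finite_Prod_UNIV[OF fin] by (intro sum.mono_neutral_cong_left) auto
  also have "\<dots> = (\<Sum>m\<in>UNIV. \<Sum>l'\<in>UNIV. if compatible l m l'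
      then weight l' * (\<Sum>xs\<in>labellings l' n. walk_weight xs) else 0)"
    by (simp add: sum.cartesian_product case_prod_beta)
  finally show ?thesis .
qed

text \<open>A label \<open>Inner\<close> or \<open>Outer\<close> can be followed by three weights \<open>317 / 1000\<close> and six weights
  \<open>1 / 1000\<close>, any other label by four of the former and nine of the latter.\<close>

lemma sum_labellings_le:
  "(\<Sum>xs\<in>labellings l n. walk_weight xs) \<le>
    (if l = Inner \<or> l = Outer then 1 else 2) * (97 / 100) ^ n"
proof (induction n arbitrary: l)
  case (Suc n)
  let ?S = "\<lambda>l. \<Sum>xs\<in>labellings l n. walk_weight xs"
  have "?S Inner \<le> (97 / 100) ^ n" "?S Outer \<le> (97 / 100) ^ n" "?S Late \<le> 2 * (97 / 100) ^ n"
    "?S Bad_Inner \<le> 2 * (97 / 100) ^ n" "?S Bad_Outer \<le> 2 * (97 / 100) ^ n"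
    using Suc[of Inner] Suc[of Outer] Suc[of Late] Suc[of Bad_Inner] Suc[of Bad_Outer]
    by (simp_all only: label.distinct simp_thms if_True if_False mult_1)
  moreover have pos: "0 \<le> (97 / 100 :: real) ^ n" by simp
  \<comment> \<open>One step costs 3 * 317 / 1000 + 6 * 2 / 1000 = 963 / 1000 from
    \<open>Inner\<close> or \<open>Outer\<close>, and 4 * 317 / 1000 + 9 * 2 / 1000 = 1286 / 1000 <=
    2 * 97 / 100 from the other labels.\<close>
  ultimately show ?case
    unfolding sum_labellings_Suc
    by (cases l; simp add: UNIV_turn UNIV_label compatible_def weight_def; use pos in linarith)
qed (simp add: weight_def)

section \<open>Probability of one labelled contour and the union bound\<close>

abbreviation model :: "nat pmf \<Rightarrow> ((edge \<Rightarrow> real) \<times> (vertex \<Rightarrow> nat)) measure" where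
  "model \<rho> \<equiv> clock_measure \<Otimes>\<^sub>M constraint_measure \<rho>"

lemma prob_space_clock: "prob_space clock_measure"
  unfolding clock_measure_def by (intro prob_space_PiM prob_space_unif)

lemma prob_space_constraint: "prob_space (constraint_measure \<rho>)"
  unfolding constraint_measure_def by (intro prob_space_PiM prob_space_measure_pmf)

lemma emeasure_constraints:
  assumes "finite V"
  shows "emeasure (constraint_measure \<rho>) {\<kappa> \<in> space (constraint_measure \<rho>). \<forall>v\<in>V. \<kappa> v \<noteq> 3} =
    ennreal ((1 - pmf \<rho> 3) ^ card V)"
proof -
  interpret prob_space "measure_pmf \<rho>" by (rule prob_space_measure_pmf)
  interpret product_prob_space "\<lambda>_. measure_pmf \<rho>" "UNIV :: vertex set" by unfold_locales
  have "measure (measure_pmf \<rho>) (UNIV - {3}) = 1 - pmf \<rho> 3"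
    using measure_pmf.prob_compl[of "{3}" \<rho>]
    unfolding measure_pmf_single space_measure_pmf sets_measure_pmf by blast
  then have "emeasure (measure_pmf \<rho>) (UNIV - {3}) = ennreal (1 - pmf \<rho> 3)"
    by (simp only: measure_pmf.emeasure_eq_measure)
  then have "(\<Prod>v\<in>V. emeasure (measure_pmf \<rho>) (UNIV - {3})) = ennreal ((1 - pmf \<rho> 3) ^ card V)"
    by (simp only: prod_constant ennreal_power pmf_le_1 diff_ge_0_iff_ge)
  moreover have "emeasure (constraint_measure \<rho>) {\<kappa> \<in> space (constraint_measure \<rho>). \<forall>v\<in>V. \<kappa> v \<in> UNIV - {3}} =
      (\<Prod>v\<in>V. emeasure (measure_pmf \<rho>) (UNIV - {3}))"
    unfolding constraint_measure_def using assms by (intro emeasure_PiM_Collect) simp_all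
  ultimately show ?thesis
    by (simp only: Diff_iff UNIV_I singleton_iff simp_thms)
qed

lemma ennreal_le_of_power2_le:
  assumes "x\<^sup>2 \<le> ennreal (y\<^sup>2)" "0 \<le> y"
  shows "x \<le> ennreal y"
proof (cases x)
  case (real r)
  then have "ennreal (r\<^sup>2) \<le> ennreal (y\<^sup>2)" using assms(1) by (simp only: ennreal_power)
  then have "r\<^sup>2 \<le> y\<^sup>2" by (simp add: ennreal_le_iff)
  then show ?thesis using power2_le_imp_le assms(2) real by (simp only: ennreal_le_iff)
next
  case top
  then show ?thesis using assms(1) by (simp add: ennreal_top_eq_mult_iff power2_eq_square top_unique)
qed

lemma neighbours_parity:
  assumes "{v, v'} \<in> lattice_edges"
  shows "even (fst v + snd v) \<noteq> even (fst v' + snd v')"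
proof -
  obtain a b where "{v, v'} = {a, b}" and "\<bar>fst a - fst b\<bar> + \<bar>snd a - snd b\<bar> = 1"
    using assms by (auto simp: lattice_edges_def)
  then have "\<bar>fst v - fst v'\<bar> + \<bar>snd v - snd v'\<bar> = 1"
    by (auto simp: doubleton_eq_iff)
  then show ?thesis by presburger
qed

text \<open>A common edge would have both vertices as its endpoints, making them neighbours and so
  of opposite parity. Parity of the pivot therefore serves as the colouring in
  \<open>emeasure_clocks\<close>.\<close>

lemma stars_disjoint:
  assumes "v \<noteq> v'" "even (fst v + snd v) = even (fst v' + snd v')"
  shows "star v \<inter> star v' = {}"
proof (rule ccontr)
  assume "star v \<inter> star v' \<noteq> {}"
  then obtain f where f: "f \<in> lattice_edges" "v \<in> f" "v' \<in> f" by (auto simp: star_def)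
  then obtain a b where "f = {a, b}" unfolding lattice_edges_def by blast
  then have "f = {v, v'}" using f assms(1) by auto
  then show False using neighbours_parity assms(2) f(1) by blast
qed

lemma pivot_in_edge: "pivot w \<in> dart_edge (fst w)"
proof -
  obtain x d l where "w = ((x, d), l)" by (metis surj_pair)
  then show ?thesis by simp
qed

text \<open>The event is covered by a measurable rectangle \<open>A \<times> B\<close>, which
  separates clocks from constraints. The clause \<open>f \<notin> Q\<close> in
  \<open>explains\<close> involves neither: it is a condition on the geometry of \<open>W\<close>.
  If it fails, the event is empty; otherwise a single witness shows that the neighbours avoid the
  walk, as \<open>emeasure_clocks\<close> demands.\<close>

lemma explained_walk_bound:
  assumes dist: "distinct (map (dart_edge \<circ> fst) W)"
    and unit: "\<And>w. w \<in> set W \<Longrightarrow> snd (fst w) \<in> unit_vectors"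
    and t: "t \<in> {0..1}" "1 - t \<le> 1 / 1000" and \<rho>: "1 - pmf \<rho> 3 \<le> (1 / 1000) ^ 4"
  shows "\<exists>E\<in>sets (model \<rho>).
    {(U, \<kappa>) \<in> space (model \<rho>). \<forall>w\<in>set W. explains U \<kappa> t (walk_edges W) w} \<subseteq> E \<and>
    emeasure (model \<rho>) E \<le> ennreal (walk_weight W)"
proof (cases "\<exists>U \<kappa>. \<forall>w\<in>set W. explains U \<kappa> t (walk_edges W) w")
  case False
  then show ?thesis by (intro bexI[of _ "{}"]) auto
next
  case True
  let ?\<epsilon> = "dart_edge \<circ> fst" and ?S = "set W"
  define GW where "GW = {w \<in> ?S. snd w = Inner \<or> snd w = Outer}"
  define TW where "TW = {w \<in> ?S. snd w = Late}"
  define KW where "KW = {w \<in> ?S. snd w = Bad_Inner \<or> snd w = Bad_Outer}"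
  have inj: "inj_on ?\<epsilon> ?S" and distW: "distinct W" using dist by (auto simp: distinct_map)
  \<comment> \<open>\<open>emeasure_clocks\<close> is indexed by edges, so the labelled dart has to
    be recovered from its edge.\<close>
  define N where "N e = star (pivot (the_inv_into ?S ?\<epsilon> e)) - {e}" for e
  define col where "col e = (let v = pivot (the_inv_into ?S ?\<epsilon> e) in even (fst v + snd v))" for e
  have inv: "the_inv_into ?S ?\<epsilon> (?\<epsilon> w) = w" if "w \<in> ?S" for w
    using the_inv_into_f_f[OF inj that] .
  have N: "N (?\<epsilon> w) = star (pivot w) - {?\<epsilon> w}" if "w \<in> ?S" for w
    using inv[OF that] by (simp add: N_def)
  have edge_star: "?\<epsilon> w \<in> star (pivot w)" if "w \<in> ?S" for w
    using pivot_in_edge[of w] dart_edge_lattice[OF unit[OF that]] by (simp add: star_def)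
  have avoid: "N (?\<epsilon> w) \<inter> ?\<epsilon> ` ?S = {}" if "w \<in> GW" for w
  proof -
    have "w \<in> ?S" using that by (simp add: GW_def)
    moreover obtain p l where w: "w = (p, l)" by (metis surj_pair)
    moreover obtain U \<kappa> where "explains U \<kappa> t (walk_edges W) w" using True \<open>w \<in> ?S\<close> by blast
    ultimately show ?thesis using that N[of w] by (auto simp: GW_def image_comp)
  qed
  have GT: "?\<epsilon> ` GW \<union> ?\<epsilon> ` TW \<subseteq> ?\<epsilon> ` ?S" "GW \<subseteq> ?S" "TW \<subseteq> ?S" "KW \<subseteq> ?S"
    by (auto simp: GW_def TW_def KW_def)
  have fin: "finite GW" "finite TW" "finite KW" by (auto simp: GW_def TW_def KW_def)
  define A where "A = {U \<in> space clock_measure.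
    (\<forall>e\<in>?\<epsilon> ` GW. \<forall>f\<in>N e. U f < U e) \<and> (\<forall>e\<in>?\<epsilon> ` TW. t < U e)}"
  define B where "B = {\<kappa> \<in> space (constraint_measure \<rho>). \<forall>v\<in>pivot ` KW. \<kappa> v \<noteq> 3}"
  have A_sets: "A \<in> sets clock_measure"
  proof -
    have [measurable]: "finite (N e)" for e by (simp add: N_def)
    have [measurable]: "f \<in> N e \<Longrightarrow> f \<in> lattice_edges" for e f
      by (simp add: N_def star_def)
    have "?\<epsilon> w \<in> lattice_edges" if "w \<in> ?S" for w
      using edge_star[OF that] by (simp add: star_def)
    then have [measurable]: "e \<in> ?\<epsilon> ` GW \<Longrightarrow> e \<in> lattice_edges" "e \<in> ?\<epsilon> ` TW \<Longrightarrow> e \<in> lattice_edges" for e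
      using GT by blast+
    have [measurable]: "finite (?\<epsilon> ` GW)" "finite (?\<epsilon> ` TW)" using fin by blast+
    show ?thesis unfolding A_def clock_measure_def by measurable
  qed
  have B_sets: "B \<in> sets (constraint_measure \<rho>)"
    unfolding B_def constraint_measure_def using fin(3) by measurable
  have "(emeasure clock_measure A)\<^sup>2 \<le> ennreal ((1 / 10) ^ card (?\<epsilon> ` GW) * ((1 - t) ^ card (?\<epsilon> ` TW))\<^sup>2)"
    unfolding A_def clock_measure_def
  proof (rule emeasure_clocks[where col = col])
    have "GW \<inter> TW = {}" by (auto simp: GW_def TW_def)
    then show "?\<epsilon> ` GW \<inter> ?\<epsilon> ` TW = {}"
      by (simp only: inj_on_image_Int[OF inj GT(2,3), symmetric] image_empty)
    show "?\<epsilon> ` GW \<union> ?\<epsilon> ` TW \<subseteq> lattice_edges"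
      using edge_star GT by (auto simp: star_def)
    show "N e \<subseteq> lattice_edges - (?\<epsilon> ` GW \<union> ?\<epsilon> ` TW)" if "e \<in> ?\<epsilon> ` GW" for e
    proof -
      have "N e \<subseteq> lattice_edges" by (auto simp: N_def star_def)
      then show ?thesis using avoid that GT by blast
    qed
    show "card (N e) = 3" if e: "e \<in> ?\<epsilon> ` GW" for e
    proof -
      obtain w where "w \<in> ?S" "e = ?\<epsilon> w" using e GT by auto
      then show ?thesis using N edge_star by simp
    qed
    show "N e \<inter> N e' = {}" if e: "e \<in> ?\<epsilon> ` GW" "e' \<in> ?\<epsilon> ` GW" and "e \<noteq> e'" "col e = col e'" for e e'
    proof -
      obtain w w' where w: "w \<in> GW" "e = ?\<epsilon> w" "w' \<in> GW" "e' = ?\<epsilon> w'" using e by blast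
      then have S: "w \<in> ?S" "w' \<in> ?S" using GT by auto
      \<comment> \<open>With a common pivot, one edge would be among the neighbours of the other,
        which lie off the walk.\<close>
      have "pivot w \<noteq> pivot w'"
      proof
        assume "pivot w = pivot w'"
        then have "e' \<in> N e" using S w edge_star[of w'] N[of w] \<open>e \<noteq> e'\<close> by auto
        then show False using avoid[of w] w S by blast
      qed
      moreover have "even (fst (pivot w) + snd (pivot w)) = even (fst (pivot w') + snd (pivot w'))"
        using \<open>col e = col e'\<close> S inv w by (simp add: col_def Let_def)
      ultimately show ?thesis
        using stars_disjoint S w N by blast
    qed
  qed (use fin t in auto)
  also have "\<dots> \<le> ennreal (((317 / 1000) ^ card GW * (1 / 1000) ^ card TW)\<^sup>2)"
  proof (rule ennreal_leI)
    have "card (?\<epsilon> ` GW) = card GW" "card (?\<epsilon> ` TW) = card TW"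
      by (rule card_image[OF inj_on_subset[OF inj GT(2)]], rule card_image[OF inj_on_subset[OF inj GT(3)]])
    moreover have "(1 / 10 :: real) ^ card GW \<le> ((317 / 1000)\<^sup>2) ^ card GW"
      by (intro power_mono) (auto simp: power2_eq_square)
    then have "(1 / 10 :: real) ^ card GW \<le> ((317 / 1000) ^ card GW)\<^sup>2"
      by (simp only: power_even_eq power_mult[symmetric] mult.commute)
    moreover have "(1 - t) ^ card TW \<le> (1 / 1000) ^ card TW"
      using t by (intro power_mono) auto
    ultimately show "(1 / 10) ^ card (?\<epsilon> ` GW) * ((1 - t) ^ card (?\<epsilon> ` TW))\<^sup>2
        \<le> ((317 / 1000) ^ card GW * (1 / 1000) ^ card TW)\<^sup>2"
      using t unfolding power_mult_distrib[of _ _ 2] by (auto intro!: mult_mono power_mono[of _ _ 2])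
  qed
  finally have PA: "emeasure clock_measure A \<le> ennreal ((317 / 1000) ^ card GW * (1 / 1000) ^ card TW)"
    by (rule ennreal_le_of_power2_le) simp
  \<comment> \<open>One bad vertex can account for up to four edges of the walk. To leave a factor
    \<open>1 / 1000\<close> for each of them, the probability of a bad constraint is bounded by a
    fourth power.\<close>
  have card_KW: "card KW \<le> 4 * card (pivot ` KW)"
  proof -
    have "card KW \<le> (\<Sum>v\<in>pivot ` KW. card {w \<in> KW. pivot w = v})"
    proof -
      have "KW = (\<Union>v\<in>pivot ` KW. {w \<in> KW. pivot w = v})" by auto
      then show ?thesis using fin card_UN_le[of "pivot ` KW" "\<lambda>v. {w \<in> KW. pivot w = v}"] by simp
    qed
    also have "\<dots> \<le> (\<Sum>v\<in>pivot ` KW. 4)"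
    proof (rule sum_mono)
      fix v
      have "?\<epsilon> ` {w \<in> KW. pivot w = v} \<subseteq> star v" using edge_star GT(4) by blast
      moreover have "inj_on ?\<epsilon> {w \<in> KW. pivot w = v}"
        by (rule inj_on_subset[OF inj]) (use GT(4) in blast)
      ultimately show "card {w \<in> KW. pivot w = v} \<le> 4"
        using card_inj_on_le[of ?\<epsilon> "{w \<in> KW. pivot w = v}" "star v"] by simp
    qed
    finally show ?thesis by simp
  qed
  have "(1 - pmf \<rho> 3) ^ card (pivot ` KW) \<le> ((1 / 1000) ^ 4) ^ card (pivot ` KW)"
    using \<rho> by (intro power_mono) (auto simp: pmf_le_1)
  also have "\<dots> \<le> (1 / 1000) ^ card KW"
    unfolding power_mult[symmetric] using card_KW by (intro power_decreasing) auto
  finally have PB: "emeasure (constraint_measure \<rho>) B \<le> ennreal ((1 / 1000) ^ card KW)"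
    unfolding B_def using fin by (subst emeasure_constraints) (auto intro: ennreal_leI)
  interpret C: prob_space "constraint_measure \<rho>" by (rule prob_space_constraint)
  have "emeasure (model \<rho>) (A \<times> B) = emeasure clock_measure A * emeasure (constraint_measure \<rho>) B"
    by (rule C.emeasure_pair_measure_Times[OF A_sets B_sets])
  also have "\<dots> \<le> ennreal ((317 / 1000) ^ card GW * (1 / 1000) ^ card TW) * ennreal ((1 / 1000) ^ card KW)"
    using PA PB by (intro mult_mono) auto
  also have "\<dots> = ennreal (walk_weight W)"
  proof -
    have split: "?S = GW \<union> (TW \<union> KW)"
      using UNIV_label by (auto simp: GW_def TW_def KW_def)
    have "walk_weight W = (\<Prod>w\<in>?S. weight (snd w))"
      using distW by (simp add: prod.distinct_set_conv_list comp_def)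
    also have "\<dots> = (\<Prod>w\<in>GW. weight (snd w)) * ((\<Prod>w\<in>TW. weight (snd w)) * (\<Prod>w\<in>KW. weight (snd w)))"
    proof -
      have "GW \<inter> (TW \<union> KW) = {}" "TW \<inter> KW = {}" by (auto simp: GW_def TW_def KW_def)
      then show ?thesis unfolding split using fin by (simp only: prod.union_disjoint finite_Un)
    qed
    also have "(\<Prod>w\<in>GW. weight (snd w)) = (317 / 1000) ^ card GW"
      unfolding prod_constant[symmetric] by (rule prod.cong) (auto simp: weight_def GW_def)
    also have "(\<Prod>w\<in>TW. weight (snd w)) = (1 / 1000) ^ card TW"
      unfolding prod_constant[symmetric] by (rule prod.cong) (auto simp: weight_def TW_def)
    also have "(\<Prod>w\<in>KW. weight (snd w)) = (1 / 1000) ^ card KW"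
      unfolding prod_constant[symmetric] by (rule prod.cong) (auto simp: weight_def KW_def)
    finally have "walk_weight W = (317 / 1000) ^ card GW * (1 / 1000) ^ card TW * (1 / 1000) ^ card KW"
      by (simp only: mult.assoc)
    then show ?thesis
      by (simp only:) (rule ennreal_mult[symmetric], simp_all)
  qed
  finally have "emeasure (model \<rho>) (A \<times> B) \<le> ennreal (walk_weight W)" .
  moreover have "{(U, \<kappa>) \<in> space (model \<rho>). \<forall>w\<in>?S. explains U \<kappa> t (walk_edges W) w} \<subseteq> A \<times> B"
  proof clarify
    fix U \<kappa> assume sp: "(U, \<kappa>) \<in> space (model \<rho>)" and ex: "\<forall>w\<in>?S. explains U \<kappa> t (walk_edges W) w"
    have "U f < U (?\<epsilon> w)" if "w \<in> GW" "f \<in> N (?\<epsilon> w)" for w f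
      using that ex[rule_format, of w] N[of w] by (cases w) (auto simp: GW_def)
    moreover have "t < U (?\<epsilon> w)" if "w \<in> TW" for w
      using that ex[rule_format, of w] by (cases w) (auto simp: TW_def)
    moreover have "\<kappa> (pivot w) \<noteq> 3" if "w \<in> KW" for w
      using that ex[rule_format, of w] by (cases w) (auto simp: KW_def)
    ultimately show "U \<in> A \<and> \<kappa> \<in> B"
      using sp by (auto simp: A_def B_def space_pair_measure)
  qed
  ultimately show ?thesis
    using A_sets B_sets by (intro bexI[of _ "A \<times> B"]) auto
qed

lemma labelled_walk_unit:
  "snd p \<in> unit_vectors \<Longrightarrow> w \<in> set (labelled_walk p l xs) \<Longrightarrow> snd (fst w) \<in> unit_vectors"
  by (induction p l xs rule: labelled_walk.induct) (auto intro: turn_dart_unit)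

lemma labelled_walk_weight: "walk_weight (labelled_walk p l xs) = weight l * walk_weight xs"
  by (induction p l xs rule: labelled_walk.induct) auto

definition blocked_at :: "real \<Rightarrow> nat \<Rightarrow> (edge \<Rightarrow> real) \<Rightarrow> (vertex \<Rightarrow> nat) \<Rightarrow> bool" where
  "blocked_at t k U \<kappa> \<longleftrightarrow> (\<exists>l. \<exists>xs\<in>labellings l k. let W = labelled_walk ((0, int k), (0, 1)) l xs in
    distinct (map (dart_edge \<circ> fst) W) \<and> (\<forall>w\<in>set W. explains U \<kappa> t (walk_edges W) w))"

text \<open>A union bound over the labelled walks with distinct edges; the sum of their weights is
  then enlarged to all labellings, where the transfer recursion applies.\<close>

lemma blocked_at_bound:
  assumes t: "t \<in> {0..1}" "1 - t \<le> 1 / 1000" and \<rho>: "1 - pmf \<rho> 3 \<le> (1 / 1000) ^ 4"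
  shows "\<exists>E\<in>sets (model \<rho>). {(U, \<kappa>) \<in> space (model \<rho>). blocked_at t k U \<kappa>} \<subseteq> E \<and>
    emeasure (model \<rho>) E \<le> ennreal ((97 / 100) ^ k)"
proof -
  let ?M = "model \<rho>"
  define W where "W i = labelled_walk ((0, int k), (0, 1)) (fst i) (snd i)" for i
  define I where "I = (SIGMA l:UNIV. {xs \<in> labellings l k. distinct (map (dart_edge \<circ> fst) (W (l, xs)))})"
  have finl: "finite (UNIV :: label set)" by (simp add: UNIV_label)
  then have finI: "finite I" unfolding I_def by (intro finite_SigmaI) auto
  define S where "S i = {(U, \<kappa>) \<in> space ?M. \<forall>w\<in>set (W i). explains U \<kappa> t (walk_edges (W i)) w}" for i
  have "\<forall>i\<in>I. \<exists>E. E \<in> sets ?M \<and> S i \<subseteq> E \<and> emeasure ?M E \<le> ennreal (walk_weight (W i))"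
  proof
    fix i assume i: "i \<in> I"
    have "\<exists>E\<in>sets ?M. S i \<subseteq> E \<and> emeasure ?M E \<le> ennreal (walk_weight (W i))"
      unfolding S_def
    proof (rule explained_walk_bound[OF _ _ t \<rho>])
      show "distinct (map (dart_edge \<circ> fst) (W i))" using i by (cases i) (simp add: I_def)
      show "snd (fst w) \<in> unit_vectors" if "w \<in> set (W i)" for w
        by (rule labelled_walk_unit[OF _ that[unfolded W_def]]) (simp add: unit_vectors_def)
    qed
    then show "\<exists>E. E \<in> sets ?M \<and> S i \<subseteq> E \<and> emeasure ?M E \<le> ennreal (walk_weight (W i))"
      by blast
  qed
  from bchoice[OF this] obtain E where E: "\<And>i. i \<in> I \<Longrightarrow> E i \<in> sets ?M"
    "\<And>i. i \<in> I \<Longrightarrow> S i \<subseteq> E i" "\<And>i. i \<in> I \<Longrightarrow> emeasure ?M (E i) \<le> ennreal (walk_weight (W i))"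
    by blast
  have "emeasure ?M (\<Union>i\<in>I. E i) \<le> (\<Sum>i\<in>I. emeasure ?M (E i))"
    using E(1) finI by (intro emeasure_subadditive_finite) blast+
  also have "\<dots> \<le> (\<Sum>i\<in>I. ennreal (walk_weight (W i)))"
    by (rule sum_mono) (rule E(3))
  also have "\<dots> = ennreal (\<Sum>i\<in>I. walk_weight (W i))"
    by (rule sum_ennreal) simp
  also have "(\<Sum>i\<in>I. walk_weight (W i)) = (\<Sum>(l, xs)\<in>I. weight l * walk_weight xs)"
    by (simp only: W_def labelled_walk_weight split_beta')
  also have "\<dots> \<le> ennreal (\<Sum>(l, xs)\<in>(SIGMA l:UNIV. labellings l k). weight l * walk_weight xs)"
    using finl unfolding I_def
    by (intro ennreal_leI sum_mono2 finite_SigmaI finite_labellings) (auto intro!: mult_nonneg_nonneg)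
  also have "(\<Sum>(l, xs)\<in>(SIGMA l:UNIV. labellings l k). weight l * walk_weight xs) =
      (\<Sum>l\<in>UNIV. weight l * (\<Sum>xs\<in>labellings l k. walk_weight xs))"
    using finl by (subst sum.Sigma[symmetric]) (auto simp: sum_distrib_left)
  also have "\<dots> \<le> (\<Sum>l\<in>UNIV. weight l * ((if l = Inner \<or> l = Outer then 1 else 2) * (97 / 100) ^ k))"
    by (intro sum_mono mult_left_mono sum_labellings_le) simp
  \<comment> \<open>Summing over the first label gives the factor 2 * 317 / 1000 + 3 * 2 / 1000 =
    640 / 1000 <= 1.\<close>
  also have "\<dots> \<le> (97 / 100) ^ k"
    by (simp add: UNIV_label weight_def)
  finally have "emeasure ?M (\<Union>i\<in>I. E i) \<le> ennreal ((97 / 100) ^ k)" by (simp add: ennreal_leI)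
  moreover have "{(U, \<kappa>) \<in> space ?M. blocked_at t k U \<kappa>} \<subseteq> (\<Union>i\<in>I. E i)"
  proof clarify
    fix U \<kappa> assume sp: "(U, \<kappa>) \<in> space ?M" and "blocked_at t k U \<kappa>"
    then obtain l xs where i: "(l, xs) \<in> I"
      and "\<forall>w\<in>set (W (l, xs)). explains U \<kappa> t (walk_edges (W (l, xs))) w"
      unfolding blocked_at_def Let_def I_def W_def by auto
    then have "(U, \<kappa>) \<in> S (l, xs)" using sp by (simp only: S_def mem_Collect_eq case_prod_conv)
    then show "(U, \<kappa>) \<in> (\<Union>i\<in>I. E i)" using E(2) i by blast
  qed
  moreover have "(\<Union>i\<in>I. E i) \<in> sets ?M" using E(1) finI by blast
  ultimately show ?thesis by blast
qed

section \<open>Measurability of the configuration\<close>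

definition neighbours :: "edge \<Rightarrow> edge set" where
  "neighbours e = {f \<in> lattice_edges. f \<inter> e \<noteq> {}}"

lemma neighbours_subset:
  assumes "e \<in> lattice_edges"
  obtains a b where "neighbours e \<subseteq> star a \<union> star b"
proof -
  obtain a b where "e = {a, b}" using assms unfolding lattice_edges_def by blast
  then have "neighbours e \<subseteq> star a \<union> star b" by (auto simp: neighbours_def star_def)
  then show thesis by (rule that)
qed

lemma finite_neighbours: "e \<in> lattice_edges \<Longrightarrow> finite (neighbours e)"
  by (metis neighbours_subset finite_UnI finite_star finite_subset)

text \<open>Both stars count \<open>e\<close> itself; the crude bound 8 is enough against the
  sixteen cells used below.\<close>

lemma card_neighbours: "e \<in> lattice_edges \<Longrightarrow> card (neighbours e) \<le> 8"
proof -
  assume "e \<in> lattice_edges"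
  then obtain a b where "neighbours e \<subseteq> star a \<union> star b" by (rule neighbours_subset)
  then have "card (neighbours e) \<le> card (star a \<union> star b)" by (intro card_mono) auto
  also have "\<dots> \<le> card (star a) + card (star b)" by (rule card_Un_le)
  finally show ?thesis by simp
qed

lemma finite_edge: "e \<in> lattice_edges \<Longrightarrow> finite e"
  by (auto simp: lattice_edges_def)

lemma countable_lattice_edges: "countable lattice_edges"
  by (rule countable_subset[of _ "(\<lambda>(u, v). {u, v}) ` UNIV"]) (auto simp: lattice_edges_def)

text \<open>Since every edge has only finitely many neighbours, the accessible part of \<open>earlier U\<close> is exhausted
  after \<open>\<omega>\<close> stages.\<close>

fun tame :: "(edge \<Rightarrow> real) \<Rightarrow> nat \<Rightarrow> edge \<Rightarrow> bool" where
  "tame U 0 e \<longleftrightarrow> False"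
| "tame U (Suc n) e \<longleftrightarrow> (\<forall>f\<in>neighbours e. U f < U e \<longrightarrow> tame U n f)"

lemma tame_mono: "tame U m e \<Longrightarrow> m \<le> n \<Longrightarrow> tame U n e"
proof (induction m arbitrary: n e)
  case (Suc m)
  then obtain n' where "n = Suc n'" "m \<le> n'" by (metis Suc_le_D Suc_le_mono)
  then show ?case using Suc by auto
qed simp

lemma tame_acc: "tame U n e \<Longrightarrow> e \<in> Wellfounded.acc (earlier U)"
proof (induction n arbitrary: e)
  case (Suc n)
  show ?case
  proof (rule accI)
    fix f assume "(f, e) \<in> earlier U"
    then show "f \<in> Wellfounded.acc (earlier U)"
      using Suc by (auto simp: earlier_def neighbours_def)
  qed
qed simp

text \<open>Well-foundedness becomes a countable combination of conditions on finitely many clocks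
  each, which is what makes it measurable.\<close>

lemma wf_iff_tame: "wf (earlier U) \<longleftrightarrow> (\<forall>e\<in>lattice_edges. \<exists>n. tame U n e)"
proof
  assume wf: "wf (earlier U)"
  have "e \<in> lattice_edges \<longrightarrow> (\<exists>n. tame U n e)" for e
    using wf
  proof (induction e rule: wf_induct_rule)
    case (less e)
    show ?case
    proof
      assume e: "e \<in> lattice_edges"
      have "\<exists>n. U f < U e \<longrightarrow> tame U n f" if "f \<in> neighbours e" for f
        using less.IH[of f] that e by (auto simp: earlier_def neighbours_def)
      then obtain n where n: "\<And>f. f \<in> neighbours e \<Longrightarrow> U f < U e \<Longrightarrow> tame U (n f) f" by metis
      define m where "m = Max (n ` neighbours e)"
      have "tame U m f" if "f \<in> neighbours e" "U f < U e" for f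
        using n[OF that] by (rule tame_mono)
          (unfold m_def, intro Max_ge finite_imageI finite_neighbours[OF e] imageI that)
      then have "tame U (Suc m) e" by simp
      then show "\<exists>n. tame U n e" ..
    qed
  qed
  then show "\<forall>e\<in>lattice_edges. \<exists>n. tame U n e" by simp
next
  assume "\<forall>e\<in>lattice_edges. \<exists>n. tame U n e"
  moreover have "e \<in> Wellfounded.acc (earlier U)" if "e \<notin> lattice_edges" for e
    by (rule accI) (use that in \<open>simp add: earlier_def\<close>)
  ultimately have "\<forall>e. e \<in> Wellfounded.acc (earlier U)" using tame_acc by blast
  then show "wf (earlier U)" by (rule acc_wfI)
qed

text \<open>The recursion of \<open>opens\<close> cut off at depth \<open>n\<close>. The degree is a
  real sum of indicators rather than a cardinality, a form whose measurability follows from that of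
  its terms.\<close>

fun attempt :: "(edge \<Rightarrow> real) \<Rightarrow> (vertex \<Rightarrow> nat) \<Rightarrow> nat \<Rightarrow> edge \<Rightarrow> bool" where
  "attempt U \<kappa> 0 e \<longleftrightarrow> False"
| "attempt U \<kappa> (Suc n) e \<longleftrightarrow>
     (\<forall>v\<in>e. (\<Sum>f\<in>star v. if U f < U e \<and> attempt U \<kappa> n f then 1 else 0) < real (\<kappa> v))"

text \<open>The cut-off is exact on an edge that is tame at stage \<open>n\<close>: every neighbour
  with a smaller clock is tame one stage lower, so the default value at depth 0 is never
  consulted.\<close>

lemma cdp_config_attempt:
  assumes wf: "wf (earlier U)"
  shows "e \<in> lattice_edges \<Longrightarrow> tame U n e \<Longrightarrow> cdp_config U \<kappa> t e \<longleftrightarrow> U e \<le> t \<and> attempt U \<kappa> n e"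
proof (induction n arbitrary: e t)
  case (Suc n)
  have open_eq: "{f \<in> lattice_edges. v \<in> f \<and> (\<exists>r<U e. cdp_config U \<kappa> r f)} =
      {f \<in> star v. U f < U e \<and> attempt U \<kappa> n f}" if v: "v \<in> e" for v
  proof -
    have "(\<exists>r<U e. cdp_config U \<kappa> r f) \<longleftrightarrow> U f < U e \<and> attempt U \<kappa> n f" if "f \<in> star v" for f
    proof (cases "U f < U e")
      case True
      then have "tame U n f" using Suc.prems that v by (auto simp: neighbours_def star_def)
      then have "cdp_config U \<kappa> r f \<longleftrightarrow> U f \<le> r \<and> attempt U \<kappa> n f" for r
        using that by (intro Suc.IH) (simp_all add: star_def)
      then show ?thesis using True by (auto intro: dense)
    next
      case False
      then show ?thesis using cdp_config_eq[OF wf, of f] that by (fastforce simp: star_def)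
    qed
    then show ?thesis by (auto simp: star_def)
  qed
  have deg_eq: "real (deg_before (cdp_config U \<kappa>) v (U e)) =
      (\<Sum>f\<in>star v. if U f < U e \<and> attempt U \<kappa> n f then 1 else 0)" if "v \<in> e" for v
    unfolding deg_before_def open_eq[OF that] by (simp add: sum.inter_filter[symmetric])
  have "deg_before (cdp_config U \<kappa>) v (U e) < \<kappa> v \<longleftrightarrow>
      (\<Sum>f\<in>star v. if U f < U e \<and> attempt U \<kappa> n f then 1 else 0) < real (\<kappa> v)" if "v \<in> e" for v
    unfolding deg_eq[OF that, symmetric] by simp
  then show ?case unfolding cdp_config_eq[OF wf Suc.prems(1)] attempt.simps by blast
qed simp

lemma cdp_config_iff:
  assumes "e \<in> lattice_edges"
  shows "cdp_config U \<kappa> t e \<longleftrightarrow>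
    wf (earlier U) \<and> U e \<le> t \<and> (\<exists>n. tame U n e \<and> attempt U \<kappa> n e)"
proof (cases "wf (earlier U)")
  case True
  then show ?thesis using cdp_config_attempt[OF True assms] wf_iff_tame[of U] assms by blast
next
  case False
  then show ?thesis using assms by (simp add: cdp_config_def opens_def)
qed

lemma measurable_clock [measurable]:
  assumes "e \<in> lattice_edges"
  shows "(\<lambda>x. fst x e) \<in> borel_measurable (model \<rho>)"
proof -
  have "(\<lambda>U. U e) \<in> clock_measure \<rightarrow>\<^sub>M unif"
    unfolding clock_measure_def by (rule measurable_component_singleton[OF assms])
  then have "(\<lambda>U. U e) \<in> borel_measurable clock_measure"
    by (simp only: measurable_cong_sets[OF refl sets_unif])
  then show ?thesis by (rule measurable_compose[OF measurable_fst])
qed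

lemma measurable_constraint [measurable]: "(\<lambda>x. real (snd x v)) \<in> borel_measurable (model \<rho>)"
proof -
  have "(\<lambda>\<kappa>. \<kappa> v) \<in> constraint_measure \<rho> \<rightarrow>\<^sub>M measure_pmf \<rho>"
    unfolding constraint_measure_def by (rule measurable_component_singleton) simp
  then have "(\<lambda>\<kappa>. real (\<kappa> v)) \<in> borel_measurable (constraint_measure \<rho>)"
    by (rule measurable_compose) simp
  then show ?thesis by (rule measurable_compose[OF measurable_snd])
qed

lemma measurable_tame [measurable]:
  "e \<in> lattice_edges \<Longrightarrow> Measurable.pred (model \<rho>) (\<lambda>x. tame (fst x) n e)"
proof (induction n arbitrary: e)
  case (Suc n)
  note Suc.prems[measurable] finite_neighbours[OF Suc.prems, measurable]
  have [measurable]: "f \<in> neighbours e \<Longrightarrow> f \<in> lattice_edges" for f by (simp add: neighbours_def)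
  note Suc.IH[measurable]
  show ?case unfolding tame.simps by measurable
qed simp

lemma measurable_attempt [measurable]:
  "e \<in> lattice_edges \<Longrightarrow> Measurable.pred (model \<rho>) (\<lambda>x. attempt (fst x) (snd x) n e)"
proof (induction n arbitrary: e)
  case (Suc n)
  note Suc.prems[measurable] finite_edge[OF Suc.prems, measurable]
  have [measurable]: "f \<in> star v \<Longrightarrow> f \<in> lattice_edges" for f v by (simp add: star_def)
  note Suc.IH[measurable]
  show ?case unfolding attempt.simps by measurable
qed simp

lemma measurable_wf [measurable]: "Measurable.pred (model \<rho>) (\<lambda>x. wf (earlier (fst x)))"
proof -
  note countable_lattice_edges[measurable]
  show ?thesis unfolding wf_iff_tame by measurable
qed

lemma measurable_cdp_config: "(\<lambda>(U, \<kappa>). cdp_config U \<kappa> t) \<in> model \<rho> \<rightarrow>\<^sub>M config_space"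
proof -
  have "(\<lambda>x. \<lambda>e\<in>lattice_edges. cdp_config (fst x) (snd x) t e) \<in> model \<rho> \<rightarrow>\<^sub>M config_space"
    unfolding config_space_def
  proof (rule measurable_restrict)
    fix e assume [measurable]: "e \<in> lattice_edges"
    show "(\<lambda>x. cdp_config (fst x) (snd x) t e) \<in> model \<rho> \<rightarrow>\<^sub>M count_space UNIV"
      unfolding cdp_config_iff[OF \<open>e \<in> lattice_edges\<close>] by measurable
  qed
  then show ?thesis by (simp add: cdp_config_def split_beta' cong: restrict_cong)
qed

section \<open>Measurability of clusters\<close>

lemma measurable_cluster:
  "Measurable.pred config_space (\<lambda>\<omega>. v \<in> open_cluster \<omega> x)"
proof -
  let ?R = "\<lambda>\<omega>. {(u, v). {u, v} \<in> lattice_edges \<and> \<omega> {u, v}}"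
  have edge [measurable]: "Measurable.pred config_space (\<lambda>\<omega>. e \<in> lattice_edges \<and> \<omega> e)" for e
  proof (cases "e \<in> lattice_edges")
    case True
    then have "(\<lambda>\<omega>. \<omega> e) \<in> config_space \<rightarrow>\<^sub>M count_space UNIV"
      unfolding config_space_def by (rule measurable_component_singleton)
    then show ?thesis using True by simp
  qed simp
  have "Measurable.pred config_space (\<lambda>\<omega>. (x, v) \<in> ?R \<omega> ^^ n)" for n
  proof (induction n arbitrary: v)
    case 0
    show ?case by simp
  next
    case (Suc n)
    have "(x, v) \<in> ?R \<omega> ^^ Suc n \<longleftrightarrow>
        (\<exists>u. (x, u) \<in> ?R \<omega> ^^ n \<and> {u, v} \<in> lattice_edges \<and> \<omega> {u, v})" for \<omega>
      by auto
    then show ?case using Suc[measurable] by (simp del: relpow.simps)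
  qed
  note [measurable] = this
  have "v \<in> open_cluster \<omega> x \<longleftrightarrow> (\<exists>n. (x, v) \<in> ?R \<omega> ^^ n)" for \<omega>
    by (auto simp: open_cluster_def rtrancl_power)
  then show ?thesis by simp
qed

text \<open>There are only countably many finite sets of vertices, and being infinite means being
  covered by none of them.\<close>

lemma measurable_infinite_cluster:
  "Measurable.pred config_space (\<lambda>\<omega>. infinite (open_cluster \<omega> x))"
proof -
  have eq: "infinite (open_cluster \<omega> x) \<longleftrightarrow> (\<forall>F\<in>{F. finite F}. \<exists>v. v \<notin> F \<and> v \<in> open_cluster \<omega> x)" for \<omega>
    by (metis (mono_tags, lifting) finite_subset mem_Collect_eq subsetI)
  have [measurable]: "countable {F :: vertex set. finite F}"
    by (rule countable_Collect_finite)
  note measurable_cluster[measurable]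
  show ?thesis unfolding eq by measurable
qed

lemma sets_origin_percolates: "origin_percolates \<in> sets config_space"
  using measurable_infinite_cluster[of "(0, 0)"] by (simp add: origin_percolates_def pred_def)

section \<open>Well-foundedness, translation invariance and percolation\<close>

fun edge_paths :: "edge \<Rightarrow> nat \<Rightarrow> edge list set" where
  "edge_paths e 0 = {[e]}"
| "edge_paths e (Suc n) = (\<Union>f\<in>neighbours e. (#) e ` edge_paths f n)"

lemma edge_paths_finite_card:
  "e \<in> lattice_edges \<Longrightarrow> finite (edge_paths e n) \<and> card (edge_paths e n) \<le> 8 ^ n"
proof (induction n arbitrary: e)
  case (Suc n)
  have lat: "f \<in> lattice_edges" if "f \<in> neighbours e" for f using that by (simp add: neighbours_def)
  have "card (edge_paths e (Suc n)) \<le> (\<Sum>f\<in>neighbours e. card ((#) e ` edge_paths f n))"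
    using card_UN_le[OF finite_neighbours[OF Suc.prems]] by simp
  also have "\<dots> \<le> (\<Sum>f\<in>neighbours e. 8 ^ n)"
    by (rule sum_mono) (use Suc.IH lat in \<open>simp add: card_image\<close>)
  also have "\<dots> \<le> 8 * 8 ^ n"
    using card_neighbours[OF Suc.prems] by simp
  finally show ?case
    using Suc.IH lat finite_neighbours[OF Suc.prems] by simp
qed simp

lemma edge_paths_length: "xs \<in> edge_paths e n \<Longrightarrow> length xs = Suc n"
  by (induction n arbitrary: e xs) auto

lemma edge_paths_lattice: "e \<in> lattice_edges \<Longrightarrow> xs \<in> edge_paths e n \<Longrightarrow> set xs \<subseteq> lattice_edges"
  by (induction n arbitrary: e xs) (auto simp: neighbours_def, blast)

lemma edge_paths_chain:
  assumes "\<And>i. f i \<in> lattice_edges" "\<And>i. f (Suc i) \<inter> f i \<noteq> {}"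
  shows "map f [m..<m + Suc n] \<in> edge_paths (f m) n"
proof (induction n arbitrary: m)
  case (Suc n)
  have "[m..<m + Suc (Suc n)] = m # [Suc m..<Suc m + Suc n]" by (simp add: upt_rec)
  moreover have "f (Suc m) \<in> neighbours (f m)" using assms by (simp add: neighbours_def)
  ultimately show ?case using Suc[of "Suc m"] by (auto simp del: upt_Suc)
qed simp

text \<open>The clocks along an infinite descending chain eventually stay in one cell of the partition of
  \<open>[0, 1]\<close> into sixteen intervals, whereas a path of \<open>n\<close> edges has all clocks in a given cell with
  probability at most \<open>16\<^sup>-\<^sup>n\<close>, and there are at most \<open>8\<^sup>n\<close> paths.\<close>

definition trapped :: "edge \<Rightarrow> int \<Rightarrow> (edge \<Rightarrow> real) \<Rightarrow> bool" where
  "trapped e j U \<longleftrightarrow> (\<forall>n. \<exists>xs\<in>edge_paths e n. distinct xs \<and> (\<forall>f\<in>set xs. \<lfloor>16 * U f\<rfloor> = j))"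

lemma not_wf_trapped:
  assumes "\<not> wf (earlier U)" and nonneg: "\<And>e. e \<in> lattice_edges \<Longrightarrow> 0 \<le> U e"
  shows "\<exists>e\<in>lattice_edges. \<exists>j. trapped e j U"
proof -
  obtain f where f: "\<And>i. (f (Suc i), f i) \<in> earlier U"
    using assms(1) unfolding wf_iff_no_infinite_down_chain by blast
  then have lat: "f i \<in> lattice_edges" and meet: "f (Suc i) \<inter> f i \<noteq> {}" and desc: "U (f (Suc i)) < U (f i)" for i
    by (auto simp: earlier_def)
  have anti: "U (f i') < U (f i)" if "i < i'" for i i'
    using lift_Suc_mono_less[of "\<lambda>i. - U (f i)" i i'] desc that by simp
  define c where "c i = nat \<lfloor>16 * U (f i)\<rfloor>" for i
  \<comment> \<open>Cell indices along the chain are natural numbers, so a least one is attained;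
    since they never increase, they are constant from there on.\<close>
  obtain m where m: "\<And>i. c m \<le> c i"
    using ex_has_least_nat[of "\<lambda>_. True" 0 c] by auto
  have cell: "\<lfloor>16 * U (f i)\<rfloor> = \<lfloor>16 * U (f m)\<rfloor>" if "m \<le> i" for i
  proof -
    have "U (f i) \<le> U (f m)" using anti[of m i] that by (cases "m = i") auto
    then have "\<lfloor>16 * U (f i)\<rfloor> \<le> \<lfloor>16 * U (f m)\<rfloor>" by (intro floor_mono) simp
    moreover have "0 \<le> \<lfloor>16 * U (f i)\<rfloor>" using nonneg[OF lat] by simp
    ultimately show ?thesis using m[of i] unfolding c_def by linarith
  qed
  \<comment> \<open>The edges must be distinct for their clocks to be independent.\<close>
  have "inj f" using anti by (metis injI linorder_neqE_nat order_less_irrefl)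
  have "trapped (f m) \<lfloor>16 * U (f m)\<rfloor> U"
    unfolding trapped_def
  proof
    fix n
    have "distinct (map f [m..<m + Suc n])"
      using inj_on_subset[OF \<open>inj f\<close> subset_UNIV] by (simp add: distinct_map del: upt_Suc)
    moreover have "\<forall>e\<in>set (map f [m..<m + Suc n]). \<lfloor>16 * U e\<rfloor> = \<lfloor>16 * U (f m)\<rfloor>"
    proof
      fix e assume "e \<in> set (map f [m..<m + Suc n])"
      then obtain i where "m \<le> i" "e = f i" by (auto simp del: upt_Suc)
      then show "\<lfloor>16 * U e\<rfloor> = \<lfloor>16 * U (f m)\<rfloor>" by (simp only: cell[OF \<open>m \<le> i\<close>])
    qed
    ultimately show "\<exists>xs\<in>edge_paths (f m) n. distinct xs \<and> (\<forall>e\<in>set xs. \<lfloor>16 * U e\<rfloor> = \<lfloor>16 * U (f m)\<rfloor>)"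
      using edge_paths_chain[of f m n, OF lat meet] by blast
  qed
  then show ?thesis using lat by blast
qed

lemma cell_eq: "{u. \<lfloor>16 * u\<rfloor> = j} = {real_of_int j / 16..<real_of_int (j + 1) / 16}"
  by (auto simp: floor_eq_iff field_simps)

lemma emeasure_unif_cell: "emeasure unif {u. \<lfloor>16 * u\<rfloor> = j} \<le> ennreal (1 / 16)"
proof -
  have "emeasure unif {u. \<lfloor>16 * u\<rfloor> = j} \<le> emeasure lborel {real_of_int j / 16..<real_of_int (j + 1) / 16}"
    unfolding cell_eq by (subst emeasure_unif, simp, rule emeasure_mono) auto
  also have "\<dots> = ennreal (1 / 16)" by (simp add: field_simps)
  finally show ?thesis .
qed

lemma AE_not_trapped:
  assumes e: "e \<in> lattice_edges"
  shows "AE U in clock_measure. \<not> trapped e j U"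
proof -
  interpret unif: prob_space unif by (rule prob_space_unif)
  interpret product_prob_space "\<lambda>_. unif" lattice_edges by unfold_locales
  let ?C = "{u :: real. \<lfloor>16 * u\<rfloor> = j}"
  have C [measurable]: "?C \<in> sets borel" unfolding cell_eq by simp
  define P where "P n = {xs \<in> edge_paths e n. distinct xs}" for n
  define X where "X xs = {U \<in> space clock_measure. \<forall>f\<in>set xs. U f \<in> ?C}" for xs
  have finP: "finite (P n)" and cardP: "card (P n) \<le> 8 ^ n" for n
    using edge_paths_finite_card[OF e, of n] card_mono[of "edge_paths e n" "P n"] by (auto simp: P_def)
  have X_sets: "X xs \<in> sets clock_measure" and X_le: "emeasure clock_measure (X xs) \<le> ennreal ((1 / 16) ^ n)"
    if "xs \<in> P n" for xs n
  proof -
    have sub: "set xs \<subseteq> lattice_edges" using that edge_paths_lattice[OF e] by (auto simp: P_def)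
    have "Measurable.pred clock_measure (\<lambda>U. U f \<in> ?C)" if "f \<in> set xs" for f
      unfolding clock_measure_def using that sub C by (intro pred_sets2[OF _ measurable_component_singleton]) auto
    then show "X xs \<in> sets clock_measure"
      unfolding X_def by (intro sets.sets_Collect_finite_All) (auto simp: pred_def)
    have "emeasure clock_measure (X xs) = (\<Prod>f\<in>set xs. emeasure unif ?C)"
      unfolding X_def clock_measure_def using sub by (intro emeasure_PiM_Collect) auto
    also have "\<dots> \<le> (\<Prod>f\<in>set xs. ennreal (1 / 16))"
      by (intro prod_mono_ennreal emeasure_unif_cell)
    also have "\<dots> = ennreal ((1 / 16) ^ Suc n)"
      using that edge_paths_length[of xs e n]
      by (simp only: P_def mem_Collect_eq prod_constant distinct_card ennreal_power divide_nonneg_nonneg zero_le_one zero_le_numeral)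
    \<comment> \<open>A path in \<open>edge_paths e n\<close> has \<open>n + 1\<close> edges; one
      factor is given away to match the count \<open>8 ^ n\<close>.\<close>
    also have "\<dots> \<le> ennreal ((1 / 16) ^ n)"
      by (intro ennreal_leI power_decreasing) auto
    finally show "emeasure clock_measure (X xs) \<le> ennreal ((1 / 16) ^ n)" .
  qed
  define B where "B = (\<Inter>n. \<Union>xs\<in>P n. X xs)"
  have Un_sets: "(\<Union>xs\<in>P n. X xs) \<in> sets clock_measure" for n
    using finP X_sets by blast
  then have B_sets: "B \<in> sets clock_measure" unfolding B_def by blast
  have "emeasure clock_measure B \<le> ennreal ((1 / 2) ^ n)" for n
  proof -
    have "emeasure clock_measure B \<le> emeasure clock_measure (\<Union>xs\<in>P n. X xs)"
      by (rule emeasure_mono[OF _ Un_sets]) (auto simp: B_def)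
    also have "\<dots> \<le> (\<Sum>xs\<in>P n. emeasure clock_measure (X xs))"
      using finP X_sets by (intro emeasure_subadditive_finite) blast+
    also have "\<dots> \<le> (\<Sum>xs\<in>P n. ennreal ((1 / 16) ^ n))"
      by (intro sum_mono X_le)
    also have "\<dots> = ennreal (real (card (P n)) * (1 / 16) ^ n)"
      by (simp add: ennreal_mult ennreal_of_nat_eq_real_of_nat)
    also have "\<dots> \<le> ennreal (8 ^ n * (1 / 16) ^ n)"
      using cardP[of n] by (intro ennreal_leI mult_right_mono) (simp_all flip: of_nat_le_iff)
    also have "8 ^ n * (1 / 16) ^ n = (1 / 2 :: real) ^ n"
      by (simp add: power_mult_distrib[symmetric])
    finally show ?thesis .
  qed
  moreover have "(\<lambda>n. ennreal ((1 / 2) ^ n)) \<longlonglongrightarrow> ennreal 0"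
    by (intro tendsto_ennrealI LIMSEQ_power_zero) auto
  ultimately have "emeasure clock_measure B \<le> 0"
    by (intro LIMSEQ_le_const[of _ "0 :: ennreal"]) auto
  then have "B \<in> null_sets clock_measure" using B_sets by (auto simp: null_sets_def)
  moreover have "{U \<in> space clock_measure. \<not> \<not> trapped e j U} \<subseteq> B"
    by (auto simp: trapped_def B_def P_def X_def)
  ultimately show ?thesis by (rule AE_I')
qed

lemma AE_wf: "AE U in clock_measure. wf (earlier U)"
proof -
  have "AE U in clock_measure. \<forall>e\<in>lattice_edges. U e \<in> {0..1}"
    unfolding AE_ball_countable[OF countable_lattice_edges] clock_measure_def
    by (intro ballI AE_PiM_component prob_space_unif AE_unif)
  moreover have "AE U in clock_measure. \<forall>e\<in>lattice_edges. \<forall>j. \<not> trapped e j U"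
    unfolding AE_ball_countable[OF countable_lattice_edges] AE_all_countable
    by (intro ballI allI AE_not_trapped)
  ultimately show ?thesis
  proof eventually_elim
    case (elim U)
    then show ?case using not_wf_trapped[of U] by auto
  qed
qed

lemma AE_wf_model: "AE x in model \<rho>. wf (earlier (fst x))"
proof -
  interpret C: prob_space clock_measure by (rule prob_space_clock)
  interpret K: prob_space "constraint_measure \<rho>" by (rule prob_space_constraint)
  interpret pair_sigma_finite clock_measure "constraint_measure \<rho>" by unfold_locales
  show ?thesis
    by (rule AE_pair_measure) (use AE_wf measurable_wf[of \<rho>] in \<open>auto simp: pred_def\<close>)
qed

section \<open>Translation invariance\<close>

definition shift :: "vertex \<Rightarrow> edge \<Rightarrow> edge" where
  "shift a e = (\<lambda>v. v + a) ` e"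

lemma shift_lattice: "e \<in> lattice_edges \<Longrightarrow> shift a e \<in> lattice_edges"
proof -
  assume "e \<in> lattice_edges"
  then obtain u v where "e = {u, v}" "\<bar>fst u - fst v\<bar> + \<bar>snd u - snd v\<bar> = 1"
    unfolding lattice_edges_def by blast
  then show ?thesis
    unfolding lattice_edges_def shift_def
    by (intro CollectI exI[of _ "u + a"] exI[of _ "v + a"]) simp
qed

lemma shift_shift [simp]: "shift a (shift b e) = shift (b + a) e"
  by (simp add: shift_def image_image add.assoc)

lemma shift_0 [simp]: "shift 0 e = e"
  by (simp add: shift_def)

lemma inj_shift: "inj (shift a)"
  by (rule inj_on_inverseI[of _ "shift (- a)"]) simp

lemma shift_lattice_iff [simp]: "shift a e \<in> lattice_edges \<longleftrightarrow> e \<in> lattice_edges"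
  using shift_lattice[of e a] shift_lattice[of "shift a e" "- a"] by auto

lemma mem_shift_iff [simp]: "v + a \<in> shift a e \<longleftrightarrow> v \<in> e"
  by (auto simp: shift_def)

definition shift_clocks :: "vertex \<Rightarrow> (edge \<Rightarrow> real) \<Rightarrow> edge \<Rightarrow> real" where
  "shift_clocks a U = (\<lambda>e\<in>lattice_edges. U (shift a e))"

definition shift_constraints :: "vertex \<Rightarrow> (vertex \<Rightarrow> nat) \<Rightarrow> vertex \<Rightarrow> nat" where
  "shift_constraints a \<kappa> = (\<lambda>v\<in>UNIV. \<kappa> (v + a))"

lemma distr_shift_clocks: "distr clock_measure clock_measure (shift_clocks a) = clock_measure"
  unfolding clock_measure_def shift_clocks_def[abs_def]
  by (rule distr_PiM_reindex) (auto intro: prob_space_unif inj_on_subset[OF inj_shift])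

lemma distr_shift_constraints:
  "distr (constraint_measure \<rho>) (constraint_measure \<rho>) (shift_constraints a) = constraint_measure \<rho>"
  unfolding constraint_measure_def shift_constraints_def[abs_def]
  by (rule distr_PiM_reindex) (auto intro: prob_space_measure_pmf)

lemma measurable_shift_clocks: "shift_clocks a \<in> clock_measure \<rightarrow>\<^sub>M clock_measure"
  unfolding clock_measure_def shift_clocks_def[abs_def]
  by (intro measurable_restrict measurable_component_singleton) simp

lemma measurable_shift_constraints:
  "shift_constraints a \<in> constraint_measure \<rho> \<rightarrow>\<^sub>M constraint_measure \<rho>"
  unfolding constraint_measure_def shift_constraints_def[abs_def]
  by (intro measurable_restrict measurable_component_singleton) simp

lemma distr_shift_model:
  "distr (model \<rho>) (model \<rho>) (\<lambda>(U, \<kappa>). (shift_clocks a U, shift_constraints a \<kappa>)) = model \<rho>"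
proof -
  interpret prob_space "constraint_measure \<rho>" by (rule prob_space_constraint)
  have "sigma_finite_measure (constraint_measure \<rho>)" by unfold_locales
  then show ?thesis
    using pair_measure_distr[OF measurable_shift_clocks measurable_shift_constraints, of \<rho> a a]
    by (simp add: distr_shift_clocks distr_shift_constraints)
qed

lemma wf_shift:
  assumes "wf (earlier U)"
  shows "wf (earlier (shift_clocks a U))"
proof -
  have "earlier (shift_clocks a U) \<subseteq> inv_image (earlier U) (shift a)"
    by (auto simp: earlier_def shift_clocks_def inv_image_def) (auto simp: shift_def)
  then show ?thesis using wf_inv_image[OF assms] wf_subset by blast
qed

text \<open>The translated configuration solves the defining equation for the translated clocks and
  constraints, so \<open>cdp_config_unique\<close> identifies the two.\<close>

lemma cdp_config_shift:
  assumes wf: "wf (earlier U)" and e: "e \<in> lattice_edges"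
  shows "cdp_config (shift_clocks a U) (shift_constraints a \<kappa>) t e = cdp_config U \<kappa> t (shift a e)"
proof (rule cdp_config_unique[OF wf_shift[OF wf] _ e, symmetric])
  fix e t assume e: "e \<in> lattice_edges"
  have deg: "deg_before (cdp_config U \<kappa>) (v + a) s = deg_before (\<lambda>t e. cdp_config U \<kappa> t (shift a e)) v s" for v s
  proof -
    have "{f \<in> lattice_edges. v + a \<in> f \<and> (\<exists>r<s. cdp_config U \<kappa> r f)} =
        shift a ` {f \<in> lattice_edges. v \<in> f \<and> (\<exists>r<s. cdp_config U \<kappa> r (shift a f))}" (is "?A = shift a ` ?B")
    proof
      show "?A \<subseteq> shift a ` ?B"
      proof
        fix f assume f: "f \<in> ?A"
        have "f = shift a (shift (- a) f)" by simp
        moreover have "shift (- a) f \<in> ?B"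
          using f mem_shift_iff[of v a "shift (- a) f"] by simp
        ultimately show "f \<in> shift a ` ?B" by (rule image_eqI)
      qed
    qed auto
    then show ?thesis
      unfolding deg_before_def by (simp add: card_image inj_on_subset[OF inj_shift])
  qed
  have "cdp_config U \<kappa> t (shift a e) \<longleftrightarrow> U (shift a e) \<le> t \<and>
      (\<forall>v\<in>shift a e. deg_before (cdp_config U \<kappa>) v (U (shift a e)) < \<kappa> v)"
    using e by (intro cdp_config_eq[OF wf]) simp
  also have "\<dots> \<longleftrightarrow> U (shift a e) \<le> t \<and>
      (\<forall>v\<in>e. deg_before (cdp_config U \<kappa>) (v + a) (U (shift a e)) < \<kappa> (v + a))"
    by (simp add: shift_def)
  finally show "cdp_config U \<kappa> t (shift a e) \<longleftrightarrow> shift_clocks a U e \<le> t \<and>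
      (\<forall>v\<in>e. deg_before (\<lambda>t e. cdp_config U \<kappa> t (shift a e)) v (shift_clocks a U e) < shift_constraints a \<kappa> v)"
    using e by (simp add: deg shift_clocks_def shift_constraints_def)
qed

lemma open_cluster_shift:
  assumes "\<And>e. e \<in> lattice_edges \<Longrightarrow> \<omega>' e = \<omega> (shift a e)"
  shows "open_cluster \<omega> a \<subseteq> (\<lambda>v. v + a) ` open_cluster \<omega>' 0"
proof
  fix y assume "y \<in> open_cluster \<omega> a"
  then have "(a, y) \<in> {(u, v). {u, v} \<in> lattice_edges \<and> \<omega> {u, v}}\<^sup>*" by (simp add: open_cluster_def)
  then have "y - a \<in> open_cluster \<omega>' 0"
  proof (induction rule: rtrancl_induct)
    case base
    show ?case by (simp add: open_cluster_def)
  next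
    case (step y z)
    have "shift a {y - a, z - a} = {y, z}" by (simp add: shift_def)
    then have "{y - a, z - a} \<in> lattice_edges" "\<omega>' {y - a, z - a}"
      using step.hyps(2) assms[of "{y - a, z - a}"] shift_lattice_iff[of a "{y - a, z - a}"] by auto
    then show ?case using step.IH by (auto simp: open_cluster_def intro: rtrancl_into_rtrancl)
  qed
  then show "y \<in> (\<lambda>v. v + a) ` open_cluster \<omega>' 0" by (intro image_eqI[of _ _ "y - a"]) auto
qed

section \<open>Percolation from the origin\<close>

definition infinite_at :: "real \<Rightarrow> vertex \<Rightarrow> (edge \<Rightarrow> real) \<times> (vertex \<Rightarrow> nat) \<Rightarrow> bool" where
  "infinite_at t a x \<longleftrightarrow> infinite (open_cluster (cdp_config (fst x) (snd x) t) a)"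

lemma measurable_infinite_at [measurable]: "Measurable.pred (model \<rho>) (infinite_at t a)"
  using measurable_compose[OF measurable_cdp_config measurable_infinite_cluster[of a], of t \<rho>]
  by (simp add: infinite_at_def[abs_def] split_beta')

text \<open>The model is invariant under the shift, and off the null set of ill-founded clocks the
  cluster of \<open>a\<close> lies in a translate of the cluster of the origin in the shifted
  configuration.\<close>

lemma AE_finite_cluster_shift:
  assumes "AE x in model \<rho>. \<not> infinite_at t 0 x"
  shows "AE x in model \<rho>. \<not> infinite_at t a x"
proof -
  let ?T = "\<lambda>(U, \<kappa>). (shift_clocks a U, shift_constraints a \<kappa>)"
  have T: "?T \<in> model \<rho> \<rightarrow>\<^sub>M model \<rho>"
    using measurable_shift_clocks measurable_shift_constraints by measurable
  have "AE x in distr (model \<rho>) (model \<rho>) ?T. \<not> infinite_at t 0 x"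
    using assms by (simp only: distr_shift_model)
  then have "AE x in model \<rho>. \<not> infinite_at t 0 (?T x)"
    by (rule AE_distrD[OF T])
  with AE_wf_model show ?thesis
  proof eventually_elim
    case (elim x)
    have "open_cluster (cdp_config (fst x) (snd x) t) a \<subseteq>
        (\<lambda>v. v + a) ` open_cluster (cdp_config (fst (?T x)) (snd (?T x)) t) 0"
      using elim(1) by (intro open_cluster_shift) (simp add: case_prod_beta cdp_config_shift)
    then show ?case
      using elim(2) by (auto simp: infinite_at_def intro: finite_subset)
  qed
qed

lemma measure_origin_percolates:
  "measure (cdp_law \<rho> t) origin_percolates = measure (model \<rho>) {x \<in> space (model \<rho>). infinite_at t 0 x}"
proof -
  have "(\<lambda>(U, \<kappa>). cdp_config U \<kappa> t) -` origin_percolates \<inter> space (model \<rho>) =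
      {x \<in> space (model \<rho>). infinite_at t 0 x}"
    using measurable_space[OF measurable_cdp_config[of t \<rho>]]
    by (auto simp: origin_percolates_def infinite_at_def zero_prod_def)
  then show ?thesis
    unfolding cdp_law_def by (simp add: measure_distr measurable_cdp_config sets_origin_percolates)
qed

text \<open>If the origin had probability zero, all clusters would be finite almost surely by
  translation invariance. Then for every \<open>N\<close> some contour starting at height
  \<open>k \<ge> N\<close> would be explained, yet for large \<open>N\<close> the bounds on these
  events sum to less than 1.\<close>

lemma origin_percolates_pos:
  assumes t: "t \<in> {0..1}" "1 - t \<le> 1 / 1000" and \<rho>: "1 - pmf \<rho> 3 \<le> (1 / 1000) ^ 4"
  shows "measure (cdp_law \<rho> t) origin_percolates > 0"
proof (rule ccontr)
  let ?M = "model \<rho>"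
  interpret C: prob_space clock_measure by (rule prob_space_clock)
  interpret K: prob_space "constraint_measure \<rho>" by (rule prob_space_constraint)
  interpret pair_prob_space clock_measure "constraint_measure \<rho>" by unfold_locales
  assume "\<not> ?thesis"
  then have "measure ?M {x \<in> space ?M. infinite_at t 0 x} = 0"
    by (simp add: measure_origin_percolates not_less measure_le_0_iff)
  moreover have "{x \<in> space ?M. infinite_at t 0 x} \<in> sets ?M" by measurable
  ultimately have "AE x in ?M. \<not> infinite_at t 0 x"
    using P.prob_Collect_eq_0 by blast
  then have fin: "AE x in ?M. \<forall>a. \<not> infinite_at t a x"
    unfolding AE_all_countable by (rule allI[OF AE_finite_cluster_shift])
  \<comment> \<open>\<open>3 / 100\<close> is \<open>1 - 97 / 100\<close>, so the geometric series
    started at \<open>N\<close> sums to less than 1.\<close>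
  have "\<exists>N. (97 / 100 :: real) ^ N < 3 / 100" by (rule real_arch_pow_inv) simp_all
  then obtain N where N: "(97 / 100 :: real) ^ N < 3 / 100" ..
  have "\<forall>k. \<exists>E. E \<in> sets ?M \<and> {(U, \<kappa>) \<in> space ?M. blocked_at t k U \<kappa>} \<subseteq> E \<and>
      emeasure ?M E \<le> ennreal ((97 / 100) ^ k)"
    using blocked_at_bound[OF t \<rho>] unfolding Bex_def ..
  from choice[OF this] obtain E where E: "\<And>k. E k \<in> sets ?M" "\<And>k. {(U, \<kappa>) \<in> space ?M. blocked_at t k U \<kappa>} \<subseteq> E k"
    "\<And>k. emeasure ?M (E k) \<le> ennreal ((97 / 100) ^ k)"
    by blast
  have "emeasure ?M (\<Union>k. E (k + N)) \<le> (\<Sum>k. emeasure ?M (E (k + N)))"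
    using E(1) by (intro emeasure_subadditive_countably) auto
  also have "\<dots> \<le> (\<Sum>k. ennreal ((97 / 100) ^ (k + N)))"
    by (intro suminf_le E(3)) auto
  also have "\<dots> = ennreal ((97 / 100) ^ N * (1 / (1 - 97 / 100)))"
  proof (rule suminf_ennreal_eq)
    show "(\<lambda>k. (97 / 100 :: real) ^ (k + N)) sums ((97 / 100) ^ N * (1 / (1 - 97 / 100)))"
      unfolding power_add mult.commute[of _ "_ ^ N"] by (intro sums_mult geometric_sums) simp
  qed simp
  also have "\<dots> < 1" using N by simp
  finally have "emeasure ?M (\<Union>k. E (k + N)) < 1" .
  moreover have "AE x in ?M. x \<in> (\<Union>k. E (k + N))"
    using AE_space AE_wf_model fin
  proof eventually_elim
    case (elim x)
    have "\<exists>k\<ge>N. blocked_at t k (fst x) (snd x)"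
      unfolding blocked_at_def
      using elim by (intro finite_clusters_contour) (auto simp: infinite_at_def)
    then obtain k where "N \<le> k" "blocked_at t k (fst x) (snd x)" by blast
    then have "x \<in> E (k - N + N)" using E(2)[of k] elim(1) by (cases x) auto
    then show ?case by blast
  qed
  then have "emeasure ?M (\<Union>k. E (k + N)) = 1"
    using E(1) by (intro P.emeasure_eq_1_AE) auto
  ultimately show False by simp
qed

theorem theorem1:
  "\<exists>\<eta>::real. \<eta> > 0 \<and>
     (\<forall>(\<rho>::nat pmf) (t::real).
        set_pmf \<rho> \<subseteq> {0, 1, 2, 3} \<longrightarrow> t \<in> {0..1} \<longrightarrow>
        (pmf \<rho> 3, t) \<in> {1 - \<eta><..1} \<times> {1 - \<eta><..1} \<longrightarrow>
        measure (cdp_law \<rho> t) origin_percolates > 0)"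
proof (intro exI[of _ "(1 / 1000) ^ 4"] conjI allI impI)
  fix \<rho> :: "nat pmf" and t :: real
  assume "t \<in> {0..1}" and "(pmf \<rho> 3, t) \<in> {1 - (1 / 1000) ^ 4<..1} \<times> {1 - (1 / 1000) ^ 4<..1}"
  \<comment> \<open>The fourth power serves the constraints, as a bad vertex may be the pivot of
    four contour edges; the time only has to be within \<open>1 / 1000\<close> of 1.\<close>
  moreover have "(1 / 1000 :: real) ^ 4 \<le> 1 / 1000" by (simp add: power4_eq_xxxx)
  ultimately show "measure (cdp_law \<rho> t) origin_percolates > 0"
    by (intro origin_percolates_pos) auto
qed simp

end
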